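(* Let $\mathcal{H}$ be a complex Hilbert space and let $T=U|T|$ be the polar decomposition of $T\in\mathcal{B}(\mathcal{H})$. Then for all $\lambda,t\in[0,1]$, $$\|M_\lambda(T)\|\le\max\{\|T\|^{t},\|T\|^{1-t}\}\,\big\|\lambda|T^*|^{t}+(1-\lambda)|T|^{1-t}\big\|$$ and $$\|M_\lambda(T)\|\le\sqrt{\big\|\lambda|T^*|^{2t}+(1-\lambda)|T|^{2(1-t)}\big\|\,\Big(\lambda\|T\|^{2(1-t)}+(1-\lambda)\|T\|^{2t}\Big)}.$$
   Context: $\mathcal{B}(\mathcal{H})$ denotes the bounded linear operators on $\mathcal{H}$. $|T|=(T^*T)^{1/2}$, $|T^*|=(TT^* )^{1/2}$, and $T=U|T|$ is the canonical polar decomposition ($U$ a partial isometry with $\ker U=\ker T$). The Duggal transform is $T^D=|T|U$, and the $\lambda$-mean transform is $M_\lambda(T)=\lambda T+(1-\lambda)T^D$ for $\lambda\in[0,1]$. Powers of positive operators are taken via the continuous functional calculus, with $P^0=I$. *)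

theory Defs
  imports "HOL-Analysis.Analysis" "HOL-Computational_Algebra.Polynomial"
begin

section \<open>Complex Hilbert spaces\<close>

text \<open>
  The inner product is linear in its first argument. The real scalar multiplication, the norm
  and the metric are those of the class of real normed spaces, tied to the complex structure
  by the axioms.
\<close>

class complex_inner = real_normed_vector +
  fixes scaleC :: "complex \<Rightarrow> 'a \<Rightarrow> 'a" (infixr "*\<^sub>C" 75)
    and cinner :: "'a \<Rightarrow> 'a \<Rightarrow> complex"
  assumes scaleC_add_right: "c *\<^sub>C (x + y) = c *\<^sub>C x + c *\<^sub>C y"
    and scaleC_add_left: "(c + d) *\<^sub>C x = c *\<^sub>C x + d *\<^sub>C x"
    and scaleC_scaleC: "c *\<^sub>C d *\<^sub>C x = (c * d) *\<^sub>C x"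
    and scaleC_one: "1 *\<^sub>C x = x"
    and scaleR_scaleC: "r *\<^sub>R x = complex_of_real r *\<^sub>C x"
    and cinner_commute: "cinner x y = cnj (cinner y x)"
    and cinner_add_left: "cinner (x + y) z = cinner x z + cinner y z"
    and cinner_scaleC_left: "cinner (c *\<^sub>C x) y = c * cinner x y"
    and cinner_self: "cinner x x = complex_of_real ((norm x)\<^sup>2)"

class chilbert_space = complex_inner + complete_space

instantiation complex :: chilbert_space
begin

definition scaleC_complex :: "complex \<Rightarrow> complex \<Rightarrow> complex" where
  "scaleC_complex c x = c * x"

definition cinner_complex :: "complex \<Rightarrow> complex \<Rightarrow> complex" where
  "cinner_complex x y = x * cnj y"

instance
  by standard
    (simp_all add: scaleC_complex_def cinner_complex_def algebra_simps scaleR_conv_of_real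
      complex_norm_square[symmetric] del: of_real_power)

end

lemma norm_scaleC: "norm (c *\<^sub>C x) = cmod c * norm (x :: 'a :: complex_inner)"
proof -
  have "cinner (c *\<^sub>C x) (c *\<^sub>C x) = c * cnj (c * cinner x x)"
    by (metis cinner_commute cinner_scaleC_left)
  also have "\<dots> = complex_of_real ((cmod c * norm x)\<^sup>2)"
    by (simp add: cinner_self power_mult_distrib complex_norm_square mult.assoc[symmetric]
        del: of_real_power)
  finally have "(norm (c *\<^sub>C x))\<^sup>2 = (cmod c * norm x)\<^sup>2"
    unfolding cinner_self of_real_eq_iff .
  then show ?thesis
    by (simp add: power2_eq_iff_nonneg)
qed

lemma bounded_linear_scaleC: "bounded_linear (\<lambda>x :: 'a :: complex_inner. c *\<^sub>C x)"
proof (rule bounded_linear_intro[where K = "cmod c"])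
  show "c *\<^sub>C (x + y) = c *\<^sub>C x + c *\<^sub>C y" for x y :: 'a
    by (rule scaleC_add_right)
  show "c *\<^sub>C r *\<^sub>R x = r *\<^sub>R c *\<^sub>C x" for r and x :: 'a
    by (simp add: scaleR_scaleC scaleC_scaleC mult.commute)
  show "norm (c *\<^sub>C x) \<le> norm x * cmod c" for x :: 'a
    by (simp add: norm_scaleC mult.commute)
qed

section \<open>Bounded operators\<close>

text \<open>
  The elements of the type of bounded linear maps are only real-linear; the set below singles
  out the complex-linear ones. The norm is the operator norm in either case.
\<close>

definition bounded_ops :: "('a :: complex_inner \<Rightarrow>\<^sub>L 'a) set" where
  "bounded_ops = {A. \<forall>c x. blinfun_apply A (c *\<^sub>C x) = c *\<^sub>C blinfun_apply A x}"

lift_definition op_scaleC ::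
  "complex \<Rightarrow> ('a :: complex_inner \<Rightarrow>\<^sub>L 'a) \<Rightarrow> ('a \<Rightarrow>\<^sub>L 'a)" is "\<lambda>c A x. c *\<^sub>C A x"
  by (rule bounded_linear_compose[OF bounded_linear_scaleC])

definition adj :: "('a :: chilbert_space \<Rightarrow>\<^sub>L 'a) \<Rightarrow> ('a \<Rightarrow>\<^sub>L 'a)" where
  "adj A = (THE B. \<forall>x y. cinner (blinfun_apply A x) y = cinner x (blinfun_apply B y))"

definition spectrum :: "('a :: chilbert_space \<Rightarrow>\<^sub>L 'a) \<Rightarrow> complex set" where
  "spectrum A = {z. \<not> (\<exists>B\<in>bounded_ops.
     B o\<^sub>L (A - op_scaleC z id_blinfun) = id_blinfun \<and>
     (A - op_scaleC z id_blinfun) o\<^sub>L B = id_blinfun)}"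

section \<open>Continuous functional calculus\<close>

definition poly_op ::
  "complex poly \<Rightarrow> ('a :: chilbert_space \<Rightarrow>\<^sub>L 'a) \<Rightarrow> ('a \<Rightarrow>\<^sub>L 'a)" where
  "poly_op p A = (\<Sum>i\<le>degree p. op_scaleC (coeff p i) (((o\<^sub>L) A ^^ i) id_blinfun))"

text \<open>
  The value of the continuous functional calculus of a self-adjoint operator \<open>A\<close> at a function
  \<open>f\<close> continuous on the spectrum: the norm limit of \<open>p n (A)\<close> for any polynomials \<open>p n\<close>
  converging to \<open>f\<close> uniformly on the spectrum. The spectrum of \<open>A\<close> being real, polynomials in
  one variable are dense in the continuous functions on it; for general normal operators this
  definition would not be adequate.
\<close>

definition cfc ::
  "(complex \<Rightarrow> complex) \<Rightarrow> ('a :: chilbert_space \<Rightarrow>\<^sub>L 'a) \<Rightarrow> ('a \<Rightarrow>\<^sub>L 'a)" where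
  "cfc f A = (THE B. \<exists>p :: nat \<Rightarrow> complex poly.
     uniform_limit (spectrum A) (\<lambda>n z. poly (p n) z) f sequentially \<and>
     (\<lambda>n. poly_op (p n) A) \<longlonglongrightarrow> B)"

text \<open>Real powers of nonnegative numbers with \<open>0\<^sup>0 = 1\<close>, whereas \<open>0 powr 0 = 0\<close>.\<close>

definition rpow :: "real \<Rightarrow> real \<Rightarrow> real" where
  "rpow x s = (if s = 0 then 1 else x powr s)"

text \<open>
  Meant for positive \<open>P\<close> and \<open>s \<ge> 0\<close>; the spectrum of \<open>P\<close> then consists of nonnegative reals,
  so that taking the real part only changes the type.
\<close>

definition op_pow :: "('a :: chilbert_space \<Rightarrow>\<^sub>L 'a) \<Rightarrow> real \<Rightarrow> ('a \<Rightarrow>\<^sub>L 'a)" where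
  "op_pow P s = cfc (\<lambda>z. complex_of_real (rpow (Re z) s)) P"

section \<open>Polar decomposition and mean transform\<close>

definition op_abs :: "('a :: chilbert_space \<Rightarrow>\<^sub>L 'a) \<Rightarrow> ('a \<Rightarrow>\<^sub>L 'a)" where
  "op_abs A = op_pow (adj A o\<^sub>L A) (1 / 2)"

definition op_ker :: "('a :: chilbert_space \<Rightarrow>\<^sub>L 'a) \<Rightarrow> 'a set" where
  "op_ker A = {x. blinfun_apply A x = 0}"

definition partial_isometry :: "('a :: chilbert_space \<Rightarrow>\<^sub>L 'a) \<Rightarrow> bool" where
  "partial_isometry U \<longleftrightarrow> U \<in> bounded_ops \<and>
     (\<forall>x. (\<forall>y\<in>op_ker U. cinner x y = 0) \<longrightarrow> norm (blinfun_apply U x) = norm x)"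

definition polar_isometry :: "('a :: chilbert_space \<Rightarrow>\<^sub>L 'a) \<Rightarrow> ('a \<Rightarrow>\<^sub>L 'a)" where
  "polar_isometry T = (THE U. partial_isometry U \<and> op_ker U = op_ker T \<and> T = U o\<^sub>L op_abs T)"

definition duggal :: "('a :: chilbert_space \<Rightarrow>\<^sub>L 'a) \<Rightarrow> ('a \<Rightarrow>\<^sub>L 'a)" where
  "duggal T = op_abs T o\<^sub>L polar_isometry T"

definition mean_transform :: "real \<Rightarrow> ('a :: chilbert_space \<Rightarrow>\<^sub>L 'a) \<Rightarrow> ('a \<Rightarrow>\<^sub>L 'a)" where
  "mean_transform l T = l *\<^sub>R T + (1 - l) *\<^sub>R duggal T"

end

theory Submission
  imports Defs "HOL-Computational_Algebra.Fundamental_Theorem_Algebra"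
begin

text \<open>
  Write \<open>P = \<bar>T\<bar>\<close>, \<open>Q = \<bar>T\<^sup>*\<bar>\<close>. As \<open>T = U P = Q U\<close>, the mean transform is \<open>(\<lambda> Q + (1 - \<lambda>) P) U\<close> with
  \<open>U\<close> a contraction. For the second bound split \<open>\<langle>Q u, y\<rangle> = \<langle>Q\<^bsup>1-t\<^esup> u, Q\<^bsup>t\<^esup> y\<rangle>\<close> and
  \<open>\<langle>P u, y\<rangle> = \<langle>P\<^bsup>t\<^esup> u, P\<^bsup>1-t\<^esup> y\<rangle>\<close> and apply the Cauchy-Schwarz inequality to the weighted sum. For
  the first bound put \<open>Q\<^bsup>t/2\<^esup>\<close> and \<open>P\<^bsup>(1-t)/2\<^esup>\<close> on both sides; the remaining factors \<open>Q\<^bsup>1-t\<^esup>\<close> and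
  \<open>P\<^bsup>t\<^esup>\<close> are bounded by the maximum.

  The functional calculus rests on \<open>\<parallel>p(A)\<parallel> \<le> sup \<bar>p\<bar>\<close> over the spectrum of \<open>A\<close>, which for positive
  \<open>A\<close> lies in \<open>[0, \<parallel>A\<parallel>]\<close>.
\<close>

text \<open>Both \<open>cfc\<close> and \<open>polar_isometry\<close> are definite descriptions, so
  nothing can be said about them before existence and uniqueness are settled. For \<open>cfc\<close>
  the norm bound on polynomials gives both, since any two approximating sequences stay close to each
  other. That bound is reached without spectral radii: positivity lets a coercivity argument locate
  the spectrum, and polynomials are split into linear factors over the complex numbers. For the
  polar decomposition, every admissible U is the strong limit of the same explicit operators. This
  gives uniqueness, and it is also how the contraction property and T = Q U are obtained; the latter
  starts from the associativity T (\<open>adj T\<close> T) = (T \<open>adj T\<close>) T, which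
  passes to square roots. With U standing on the right of both summands, the estimates concern two
  arbitrary positive operators whose norms have a common bound \<open>\<tau>\<close>. The relation
  between P and Q is used only to bring the mean transform into this form.\<close>

instance chilbert_space \<subseteq> banach ..

section \<open>Inner products\<close>

lemma cinner_add_right: "cinner x (y + z) = cinner x y + cinner x (z :: 'a :: complex_inner)"
  by (metis cinner_add_left cinner_commute complex_cnj_add)

lemma cinner_scaleC_right: "cinner x (c *\<^sub>C y) = cnj c * cinner x (y :: 'a :: complex_inner)"
  by (metis cinner_commute cinner_scaleC_left complex_cnj_mult)

lemma cinner_scaleR_left: "cinner (r *\<^sub>R x) y = of_real r * cinner x (y :: 'a :: complex_inner)"
  by (simp add: scaleR_scaleC cinner_scaleC_left)

lemma cinner_scaleR_right: "cinner x (r *\<^sub>R y) = of_real r * cinner x (y :: 'a :: complex_inner)"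
  by (simp add: scaleR_scaleC cinner_scaleC_right)

lemma cinner_minus_left: "cinner (- x) y = - cinner x (y :: 'a :: complex_inner)"
  using cinner_scaleR_left[of "-1" x y] by simp

lemma cinner_minus_right: "cinner x (- y) = - cinner x (y :: 'a :: complex_inner)"
  using cinner_scaleR_right[of x "-1" y] by simp

lemma cinner_diff_left: "cinner (x - y) z = cinner x z - cinner y (z :: 'a :: complex_inner)"
  using cinner_add_left[of x "- y" z] by (simp add: cinner_minus_left)

lemma cinner_diff_right: "cinner x (y - z) = cinner x y - cinner x (z :: 'a :: complex_inner)"
  using cinner_add_right[of x y "- z"] by (simp add: cinner_minus_right)

lemmas cinner_algebra = cinner_add_left cinner_add_right cinner_diff_left cinner_diff_right
  cinner_scaleC_left cinner_scaleC_right cinner_scaleR_left cinner_scaleR_right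
  cinner_minus_left cinner_minus_right

lemma cinner_zero_left [simp]: "cinner 0 (y :: 'a :: complex_inner) = 0"
  using cinner_scaleR_left[of 0 0 y] by simp

lemma cinner_zero_right [simp]: "cinner (y :: 'a :: complex_inner) 0 = 0"
  using cinner_scaleR_right[of y 0 0] by simp

lemma Re_cinner_commute: "Re (cinner x y) = Re (cinner y (x :: 'a :: complex_inner))"
  by (subst cinner_commute) simp

lemma Re_cinner_self: "Re (cinner x x) = (norm (x :: 'a :: complex_inner))\<^sup>2"
  by (simp add: cinner_self)

lemma norm_add_sq:
  "(norm (x + y))\<^sup>2 = (norm x)\<^sup>2 + 2 * Re (cinner x y) + (norm (y :: 'a :: complex_inner))\<^sup>2"
  unfolding Re_cinner_self[symmetric]
  using Re_cinner_commute[of x y] by (simp add: cinner_algebra)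

lemma norm_diff_sq:
  "(norm (x - y))\<^sup>2 = (norm x)\<^sup>2 - 2 * Re (cinner x y) + (norm (y :: 'a :: complex_inner))\<^sup>2"
  unfolding Re_cinner_self[symmetric]
  using Re_cinner_commute[of x y] by (simp add: cinner_algebra)

lemma Re_cinner_le: "Re (cinner x y) \<le> norm x * norm (y :: 'a :: complex_inner)"
proof (cases "x = 0 \<or> y = 0")
  case False
  \<comment> \<open>Scaling each vector by the norm of the other gives both the same length, so that
    the expanded square has the factor \<open>norm x * norm y - Re (cinner x y)\<close>.\<close>
  have "0 \<le> (norm (norm y *\<^sub>R x - norm x *\<^sub>R y))\<^sup>2"
    by simp
  also have "\<dots> = 2 * (norm x * norm y) * (norm x * norm y - Re (cinner x y))"
    unfolding norm_diff_sq
    by (simp add: cinner_scaleR_left cinner_scaleR_right power2_eq_square algebra_simps)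
  finally have "0 \<le> 2 * (norm x * norm y) * (norm x * norm y - Re (cinner x y))" .
  moreover have "0 < 2 * (norm x * norm y)"
    using False by simp
  ultimately show ?thesis
    by (metis diff_ge_0_iff_ge zero_le_mult_iff not_less)
qed auto

lemma cmod_cinner_le: "cmod (cinner x y) \<le> norm x * norm (y :: 'a :: complex_inner)"
proof (cases "cinner x y = 0")
  case False
  \<comment> \<open>A phase of modulus one that turns the inner product into its absolute value, so
    that the bound on real parts applies.\<close>
  define c where "c = cnj (cinner x y) / cmod (cinner x y)"
  have c: "cmod c = 1"
    using False by (simp add: c_def norm_divide)
  have "cnj (cinner x y) * cinner x y = of_real (cmod (cinner x y)) * of_real (cmod (cinner x y))"
    using complex_norm_square[of "cinner x y"] by (simp add: power2_eq_square mult.commute)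
  then have "cinner (c *\<^sub>C x) y = of_real (cmod (cinner x y))"
    unfolding c_def cinner_scaleC_left using False by simp
  then have "cmod (cinner x y) = Re (cinner (c *\<^sub>C x) y)"
    by simp
  also have "\<dots> \<le> norm x * norm y"
    using Re_cinner_le[of "c *\<^sub>C x" y] c by (simp add: norm_scaleC)
  finally show ?thesis .
qed simp

lemma bounded_bilinear_cinner:
  "bounded_bilinear (cinner :: 'a :: complex_inner \<Rightarrow> 'a \<Rightarrow> complex)"
proof
  have "\<forall>a b :: 'a. cmod (cinner a b) \<le> norm a * norm b * 1"
    by (simp add: cmod_cinner_le)
  then show "\<exists>K. \<forall>a b :: 'a. cmod (cinner a b) \<le> norm a * norm b * K"
    by blast
qed (simp_all add: cinner_algebra scaleR_conv_of_real)

lemmas tendsto_cinner = bounded_bilinear.tendsto[OF bounded_bilinear_cinner]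

lemma cinner_ext:
  assumes "\<And>x. cinner x y = cinner x (z :: 'a :: complex_inner)"
  shows "y = z"
proof -
  have "cinner (y - z) (y - z) = 0"
    using assms by (simp add: cinner_diff_right)
  then show ?thesis
    by (simp add: cinner_self)
qed

lemma norm_le_via_cinner:
  assumes "\<And>y. cmod (cinner x y) \<le> K * norm (y :: 'a :: complex_inner)" and "0 \<le> K"
  shows "norm x \<le> K"
proof (cases "x = 0")
  case False
  have "norm x * norm x \<le> K * norm x"
    using assms(1)[of x] by (simp add: cinner_self norm_mult power2_eq_square)
  then show ?thesis
    using False by simp
qed (use assms in simp)

text \<open>First-order optimality: along a line through a minimiser the linear term must vanish. It
  yields the variational equation in the Riesz theorem.\<close>

lemma quadratic_nonneg_imp_zero:
  fixes a b :: real
  assumes "\<And>s. 0 \<le> s * a + s\<^sup>2 * b"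
  shows "a = 0"
proof (rule ccontr)
  assume "a \<noteq> 0"
  \<comment> \<open>At \<open>s = - e * a\<close> the quadratic term cannot compensate the linear
    one once \<open>e * b < 1\<close>; the added 1 covers \<open>b = 0\<close>.\<close>
  define e where "e = 1 / (\<bar>b\<bar> + 1)"
  have e: "0 < e" "e * b < 1"
    by (auto simp: e_def field_simps intro: le_less_trans[OF abs_ge_self])
  have "0 \<le> (- e * a) * a + (- e * a)\<^sup>2 * b"
    by (rule assms)
  also have "\<dots> = e * a\<^sup>2 * (e * b - 1)"
    by (simp add: power2_eq_square algebra_simps)
  finally have "0 \<le> e * a\<^sup>2 * (e * b - 1)" .
  moreover have "0 < e * a\<^sup>2"
    using e \<open>a \<noteq> 0\<close> by simp
  ultimately have "0 \<le> e * b - 1"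
    by (metis mult_le_cancel_left_pos mult_zero_right)
  then show False
    using e by simp
qed

text \<open>The representing vector is the minimiser of J, since J x equals the squared distance
  from x to that vector up to a constant. Completeness supplies the minimiser as the limit of a
  minimising sequence.\<close>

lemma Riesz_representation:
  fixes \<phi> :: "'a :: chilbert_space \<Rightarrow> complex"
  assumes add: "\<And>x y. \<phi> (x + y) = \<phi> x + \<phi> y"
    and scale: "\<And>c x. \<phi> (c *\<^sub>C x) = c * \<phi> x"
    and bound: "\<And>x. cmod (\<phi> x) \<le> K * norm x"
  shows "\<exists>y. \<forall>x. \<phi> x = cinner x y"
proof -
  define J where "J x = (norm x)\<^sup>2 - 2 * Re (\<phi> x)" for x
  have scR: "\<phi> (r *\<^sub>R x) = of_real r * \<phi> x" for r x
    by (simp add: scaleR_scaleC scale)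
  have J_ge: "- K\<^sup>2 \<le> J x" for x
  proof -
    have "2 * Re (\<phi> x) \<le> 2 * (K * norm x)"
      using bound[of x] complex_Re_le_cmod[of "\<phi> x"] by linarith
    also have "\<dots> \<le> K\<^sup>2 + (norm x)\<^sup>2"
      using sum_squares_bound[of K "norm x"] by (simp add: algebra_simps)
    finally show ?thesis
      by (simp add: J_def)
  qed
  define m where "m = (INF x. J x)"
  have bdd: "bdd_below (range J)"
    using J_ge by (intro bdd_belowI2) auto
  have m_le: "m \<le> J x" for x
    unfolding m_def by (rule cINF_lower[OF bdd]) simp
  have "\<exists>x. J x < m + 1 / Suc n" for n
    using cINF_less_iff[of UNIV J "m + 1 / Suc n"] bdd by (simp add: m_def)
  then obtain X where X: "\<And>n. J (X n) < m + 1 / Suc n"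
    by metis
  \<comment> \<open>In J the linear parts at x, y and their midpoint cancel, which leaves the
    parallelogram law; the midpoint value is at least m. Near-minimisers are therefore close to each
    other.\<close>
  have para: "(norm (x - y))\<^sup>2 \<le> 2 * (J x - m) + 2 * (J y - m)" for x y
  proof -
    have "(norm (x - y))\<^sup>2 = 2 * J x + 2 * J y - 4 * J ((1 / 2) *\<^sub>R (x + y))"
      unfolding J_def scR add norm_scaleR norm_diff_sq power_mult_distrib norm_add_sq
      by (simp add: power_divide algebra_simps)
    also have "\<dots> \<le> 2 * J x + 2 * J y - 4 * m"
      using m_le[of "(1 / 2) *\<^sub>R (x + y)"] by simp
    finally show ?thesis
      by (simp add: algebra_simps)
  qed
  have "Cauchy X"
  proof (rule metric_CauchyI)
    fix e :: real assume e: "0 < e"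
    obtain N where N: "4 / Suc N < e\<^sup>2"
      using e reals_Archimedean[of "e\<^sup>2 / 4"] by (auto simp: inverse_eq_divide field_simps)
    have "dist (X k) (X n) < e" if "N \<le> k" "N \<le> n" for k n
    proof -
      have le: "J (X i) - m < 1 / Suc N" if "N \<le> i" for i
        using X[of i] frac_le[of 1 1 "Suc N" "Suc i"] that by auto
      have "(norm (X k - X n))\<^sup>2 < e\<^sup>2"
        using para[of "X k" "X n"] le[OF that(1)] le[OF that(2)] N by simp
      then show ?thesis
        using e by (simp add: dist_norm power_less_imp_less_base)
    qed
    then show "\<exists>M. \<forall>k\<ge>M. \<forall>n\<ge>M. dist (X k) (X n) < e"
      by blast
  qed
  then obtain u where u: "X \<longlonglongrightarrow> u"
    using Cauchy_convergent_iff convergent_def by blast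
  have "bounded_linear \<phi>"
    by (rule bounded_linear_intro[where K = K])
       (use bound in \<open>auto simp: add scR scaleR_conv_of_real mult.commute\<close>)
  then have "(\<lambda>n. \<phi> (X n)) \<longlonglongrightarrow> \<phi> u"
    using u by (rule bounded_linear.tendsto)
  then have "(\<lambda>n. J (X n)) \<longlonglongrightarrow> J u"
    unfolding J_def by (intro tendsto_intros u)
  moreover have "(\<lambda>n. m + 1 / Suc n) \<longlonglongrightarrow> m"
    using LIMSEQ_inverse_real_of_nat_add[of m] by (simp add: inverse_eq_divide)
  ultimately have "J u \<le> m"
    by (rule LIMSEQ_le) (use X less_imp_le in blast)
  have Re_eq: "Re (\<phi> v) = Re (cinner v u)" for v
  proof -
    have "0 \<le> s * (2 * (Re (cinner v u) - Re (\<phi> v))) + s\<^sup>2 * (norm v)\<^sup>2" for s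
    proof -
      have "J (u + s *\<^sub>R v)
          = J u + s * (2 * (Re (cinner v u) - Re (\<phi> v))) + s\<^sup>2 * (norm v)\<^sup>2"
        unfolding J_def add scR using Re_cinner_commute[of u v]
        by (simp add: norm_add_sq cinner_algebra power_mult_distrib algebra_simps)
      then show ?thesis
        using m_le[of "u + s *\<^sub>R v"] \<open>J u \<le> m\<close> by linarith
    qed
    from quadratic_nonneg_imp_zero[OF this] show ?thesis
      by simp
  qed
  \<comment> \<open>The real part at \<open>\<i> *\<^sub>C v\<close> is the negative of the
    imaginary part at v, so the equality of real parts suffices.\<close>
  have "\<phi> v = cinner v u" for v
    using Re_eq[of v] Re_eq[of "\<i> *\<^sub>C v"]
    by (simp add: complex_eq_iff scale cinner_scaleC_left)
  then show ?thesis
    by blast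
qed

section \<open>Adjoints\<close>

lemma bounded_opsD: "A \<in> bounded_ops \<Longrightarrow> blinfun_apply A (c *\<^sub>C x) = c *\<^sub>C blinfun_apply A x"
  by (simp add: bounded_ops_def)

text \<open>Riesz is applied to \<open>\<lambda>x. cinner (A x) y\<close> for each y. The dependence
  on y is linear because a vector is determined by its inner products.\<close>

lemma adj_exists:
  fixes A :: "'a :: chilbert_space \<Rightarrow>\<^sub>L 'a"
  assumes "A \<in> bounded_ops"
  shows "\<exists>B\<in>bounded_ops. (\<forall>x y. cinner (A x) y = cinner x (blinfun_apply B y)) \<and> norm B \<le> norm A"
proof -
  have "\<exists>z. \<forall>x. cinner (A x) y = cinner x z" for y
  proof (rule Riesz_representation[where K = "norm A * norm y"])
    show "cmod (cinner (A x) y) \<le> norm A * norm y * norm x" for x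
      using order_trans[OF cmod_cinner_le mult_right_mono[OF norm_blinfun norm_ge_zero]]
      by (simp add: mult_ac)
  qed (simp_all add: blinfun.bilinear_simps cinner_algebra bounded_opsD[OF assms])
  then obtain b where b: "\<And>x y. cinner (A x) y = cinner x (b y)"
    by metis
  have norm_b: "norm (b y) \<le> norm A * norm y" for y
  proof (rule norm_le_via_cinner)
    fix x
    have "cmod (cinner (b y) x) = cmod (cinner (A x) y)"
      unfolding b by (subst cinner_commute) simp
    also have "\<dots> \<le> norm (A x) * norm y"
      by (rule cmod_cinner_le)
    also have "\<dots> \<le> norm A * norm x * norm y"
      by (intro mult_right_mono norm_blinfun) simp
    finally show "cmod (cinner (b y) x) \<le> norm A * norm y * norm x"
      by (simp add: mult_ac)
  qed simp
  have b_add: "b (x + y) = b x + b y" for x y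
    by (rule cinner_ext) (simp add: cinner_add_right flip: b)
  have b_scale: "b (c *\<^sub>C x) = c *\<^sub>C b x" for c x
    by (rule cinner_ext) (simp add: cinner_scaleC_right flip: b)
  have "bounded_linear b"
    by (rule bounded_linear_intro[where K = "norm A"])
       (use norm_b in \<open>auto simp: b_add b_scale scaleR_scaleC mult.commute\<close>)
  then have app: "blinfun_apply (Blinfun b) = b"
    by (rule bounded_linear_Blinfun_apply)
  show ?thesis
    by (rule bexI[of _ "Blinfun b"])
       (auto simp: app b norm_b bounded_ops_def b_scale intro!: norm_blinfun_bound)
qed

lemma adj_unique:
  fixes A B :: "'a :: chilbert_space \<Rightarrow>\<^sub>L 'a"
  assumes "\<And>x y. cinner (A x) y = cinner x (B y)"
  shows "adj A = B"
  unfolding adj_def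
proof (rule the_equality)
  fix C :: "'a \<Rightarrow>\<^sub>L 'a"
  assume C: "\<forall>x y. cinner (A x) y = cinner x (C y)"
  have "C y = B y" for y
    by (rule cinner_ext) (metis C assms)
  then show "C = B"
    by (rule blinfun_eqI)
qed (use assms in simp)

context
  fixes A :: "'a :: chilbert_space \<Rightarrow>\<^sub>L 'a"
  assumes A: "A \<in> bounded_ops"
begin

lemma adj_in_bounded_ops: "adj A \<in> bounded_ops"
  and cinner_adj_right: "cinner (A x) y = cinner x (blinfun_apply (adj A) y)"
  and norm_adj_le: "norm (adj A) \<le> norm A"
proof -
  obtain B where "B \<in> bounded_ops" "\<And>x y. cinner (A x) y = cinner x (blinfun_apply B y)" "norm B \<le> norm A"
    using adj_exists[OF A] by blast
  moreover from this have "adj A = B"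
    by (intro adj_unique)
  ultimately show "adj A \<in> bounded_ops" "cinner (A x) y = cinner x (blinfun_apply (adj A) y)"
    "norm (adj A) \<le> norm A"
    by simp_all
qed

lemma cinner_adj_left: "cinner (blinfun_apply (adj A) x) y = cinner x (A y)"
  by (subst (1 2) cinner_commute) (simp add: cinner_adj_right)

lemma adj_adj: "adj (adj A) = A"
  by (rule adj_unique) (rule cinner_adj_left)

end

section \<open>The spectrum of a positive operator\<close>

definition positive_op :: "('a :: chilbert_space \<Rightarrow>\<^sub>L 'a) \<Rightarrow> bool" where
  "positive_op A \<longleftrightarrow> A \<in> bounded_ops \<and>
     (\<forall>x y. cinner (blinfun_apply A x) y = cinner x (blinfun_apply A y)) \<and>
     (\<forall>x. 0 \<le> Re (cinner (blinfun_apply A x) x))"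

lemma Im_cinner_self_adjoint:
  assumes "cinner (blinfun_apply A x) x = cinner x (blinfun_apply A x)"
  shows "Im (cinner (blinfun_apply A x) x) = 0"
  using assms by (subst (asm) (2) cinner_commute) (simp add: complex_eq_iff)

text \<open>Solving \<open>C x = y\<close> means finding a fixed point of
  \<open>x - e *\<^sub>R C x + e *\<^sub>R y\<close>, and coercivity makes this map a contraction
  for a small step e. Injectivity and the bound on the inverse come from
  \<open>below\<close>.\<close>

lemma Lax_Milgram:
  fixes C :: "'a :: chilbert_space \<Rightarrow>\<^sub>L 'a"
  assumes C: "C \<in> bounded_ops" and d: "0 < d"
    and coercive: "\<And>x. d * (norm x)\<^sup>2 \<le> Re (cinner (C x) x)"
  shows "\<exists>B\<in>bounded_ops. B o\<^sub>L C = id_blinfun \<and> C o\<^sub>L B = id_blinfun"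
proof -
  have below: "d * norm x \<le> norm (C x)" for x
  proof (cases "x = 0")
    case False
    have "d * norm x * norm x \<le> norm (C x) * norm x"
      using coercive[of x] Re_cinner_le[of "C x" x] by (simp add: power2_eq_square mult.assoc)
    then show ?thesis
      using False by simp
  qed simp
  \<comment> \<open>The summand \<open>d\<^sup>2\<close> keeps K positive and
    \<open>1 - d\<^sup>2 / K\<close> non-negative. The step \<open>d / K\<close> below minimises
    \<open>1 - 2 * e * d + e\<^sup>2 * K\<close>, with minimum
    \<open>1 - d\<^sup>2 / K\<close>.\<close>
  define K where "K = (norm C)\<^sup>2 + d\<^sup>2"
  have K: "0 < K"
    using d by (simp add: K_def add_nonneg_pos)
  define e where "e = d / K"
  have e: "0 < e"
    using d K by (simp add: e_def)
  define c where "c = sqrt (1 - d\<^sup>2 / K)"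
  have q01: "0 \<le> 1 - d\<^sup>2 / K" "1 - d\<^sup>2 / K < 1"
    using d K by (auto simp: K_def field_simps)
  then have c01: "0 \<le> c" "c < 1"
    by (auto simp: c_def)
  have contr: "norm (x - e *\<^sub>R C x) \<le> c * norm x" for x
  proof -
    have "(norm (C x))\<^sup>2 \<le> K * (norm x)\<^sup>2"
    proof -
      have "(norm (C x))\<^sup>2 \<le> (norm C * norm x)\<^sup>2"
        by (intro power_mono norm_blinfun) simp
      also have "\<dots> \<le> K * (norm x)\<^sup>2"
        by (simp add: K_def power_mult_distrib mult_right_mono)
      finally show ?thesis .
    qed
    then have 1: "e\<^sup>2 * (norm (C x))\<^sup>2 \<le> e\<^sup>2 * (K * (norm x)\<^sup>2)"
      by (intro mult_left_mono) auto
    have 2: "2 * e * (d * (norm x)\<^sup>2) \<le> 2 * e * Re (cinner (C x) x)"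
      using e coercive by (intro mult_left_mono) auto
    have "(norm (x - e *\<^sub>R C x))\<^sup>2
        = (norm x)\<^sup>2 - 2 * e * Re (cinner (C x) x) + e\<^sup>2 * (norm (C x))\<^sup>2"
      using Re_cinner_commute[of x "C x"]
      by (simp add: norm_diff_sq cinner_algebra power_mult_distrib)
    also have "\<dots> \<le> (norm x)\<^sup>2 - 2 * e * (d * (norm x)\<^sup>2) + e\<^sup>2 * (K * (norm x)\<^sup>2)"
      using 1 2 by linarith
    also have "\<dots> = (1 - d\<^sup>2 / K) * (norm x)\<^sup>2"
      using K by (simp add: e_def field_simps power2_eq_square)
    also have "\<dots> = (c * norm x)\<^sup>2"
      using q01 by (simp add: c_def power_mult_distrib)
    finally show ?thesis
      by (rule power2_le_imp_le) (use c01 in simp)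
  qed
  have "\<exists>x. C x = y" for y
  proof -
    have "dist (x - e *\<^sub>R C x + e *\<^sub>R y) (z - e *\<^sub>R C z + e *\<^sub>R y) \<le> c * dist x z" for x z
    proof -
      have "x - e *\<^sub>R C x + e *\<^sub>R y - (z - e *\<^sub>R C z + e *\<^sub>R y) = (x - z) - e *\<^sub>R C (x - z)"
        by (simp add: blinfun.diff_right algebra_simps)
      then show ?thesis
        unfolding dist_norm by (simp only: contr)
    qed
    then obtain x where "x - e *\<^sub>R C x + e *\<^sub>R y = x"
      using banach_fix_type[OF c01, of "\<lambda>x. x - e *\<^sub>R C x + e *\<^sub>R y"] by auto
    then have "e *\<^sub>R (y - C x) = 0"
      by (simp add: algebra_simps)
    then show ?thesis
      using e by auto
  qed
  then obtain b where b: "\<And>y. C (b y) = y"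
    by metis
  have inj: "x = y" if "C x = C y" for x y
    using below[of "x - y"] d that by (simp add: blinfun.diff_right mult_le_0_iff)
  have b_add: "b (x + y) = b x + b y" for x y
    by (rule inj) (simp add: b blinfun.add_right)
  have b_scale: "b (k *\<^sub>C x) = k *\<^sub>C b x" for k x
    by (rule inj) (simp add: b bounded_opsD[OF C])
  have "bounded_linear b"
  proof (rule bounded_linear_intro[where K = "1 / d"])
    show "norm (b x) \<le> norm x * (1 / d)" for x
      using below[of "b x"] d by (simp add: b field_simps)
  qed (simp_all add: b_add b_scale scaleR_scaleC)
  then have app: "blinfun_apply (Blinfun b) = b"
    by (rule bounded_linear_Blinfun_apply)
  have "b (C x) = x" for x
    by (rule inj) (simp add: b)
  then show ?thesis
    by (intro bexI[of _ "Blinfun b"] conjI blinfun_eqI) (auto simp: app b bounded_ops_def b_scale)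
qed

lemma op_scaleC_apply: "blinfun_apply (op_scaleC c A) x = c *\<^sub>C blinfun_apply A x"
  by (simp add: op_scaleC.rep_eq)

lemma scaleC_diff_right: "c *\<^sub>C (x - y) = c *\<^sub>C x - c *\<^sub>C (y :: 'a :: complex_inner)"
  by (rule linear_diff[OF bounded_linear.linear[OF bounded_linear_scaleC]])

lemma scaleC_zero_right [simp]: "c *\<^sub>C (0 :: 'a :: complex_inner) = 0"
  by (rule linear_0[OF bounded_linear.linear[OF bounded_linear_scaleC]])

lemma scaleC_zero_left [simp]: "0 *\<^sub>C (x :: 'a :: complex_inner) = 0"
  using scaleR_scaleC[of 0 x] by simp

text \<open>The factor w rotates the shifted operator until its quadratic form has real part bounded
  away from zero. Lax-Milgram inverts the rotated operator, and w is then moved into the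
  inverse.\<close>

lemma not_in_spectrumI:
  fixes A :: "'a :: chilbert_space \<Rightarrow>\<^sub>L 'a"
  assumes A: "A \<in> bounded_ops" and "0 < d" and w: "w \<noteq> 0"
    and "\<And>x. d * (norm x)\<^sup>2 \<le> Re (w * (cinner (A x) x - z * of_real ((norm x)\<^sup>2)))"
  shows "z \<notin> spectrum A"
proof -
  let ?D = "A - op_scaleC z id_blinfun"
  have D: "?D \<in> bounded_ops"
    by (simp add: bounded_ops_def op_scaleC_apply blinfun.diff_left bounded_opsD[OF A]
        scaleC_diff_right scaleC_scaleC mult.commute)
  have "\<exists>B\<in>bounded_ops. B o\<^sub>L op_scaleC w ?D = id_blinfun \<and> op_scaleC w ?D o\<^sub>L B = id_blinfun"
  proof (rule Lax_Milgram[OF _ \<open>0 < d\<close>])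
    show "op_scaleC w ?D \<in> bounded_ops"
      using D by (simp add: bounded_ops_def op_scaleC_apply scaleC_scaleC mult.commute)
    show "d * (norm x)\<^sup>2 \<le> Re (cinner (op_scaleC w ?D x) x)" for x
      using assms(4)[of x]
      by (simp add: op_scaleC_apply blinfun.diff_left cinner_algebra cinner_self)
  qed
  then obtain B where B: "B \<in> bounded_ops" "B o\<^sub>L op_scaleC w ?D = id_blinfun"
    "op_scaleC w ?D o\<^sub>L B = id_blinfun"
    by blast
  have "blinfun_apply (op_scaleC w B o\<^sub>L ?D) x = x" for x
    using arg_cong[OF B(2), of "\<lambda>F. blinfun_apply F x"]
    by (simp add: op_scaleC_apply bounded_opsD[OF B(1)])
  moreover have "blinfun_apply (?D o\<^sub>L op_scaleC w B) x = x" for x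
    using arg_cong[OF B(3), of "\<lambda>F. blinfun_apply F x"]
    by (simp add: op_scaleC_apply bounded_opsD[OF D])
  ultimately have "op_scaleC w B o\<^sub>L ?D = id_blinfun" "?D o\<^sub>L op_scaleC w B = id_blinfun"
    by (auto intro!: blinfun_eqI)
  moreover have "op_scaleC w B \<in> bounded_ops"
    using B(1) by (simp add: bounded_ops_def op_scaleC_apply scaleC_scaleC mult.commute)
  ultimately show ?thesis
    unfolding spectrum_def by blast
qed

text \<open>Each excluded region has its own rotation: \<open>\<i> * sgn (Im z)\<close> off the real
  axis, 1 for negative real part, -1 beyond the norm. The coercivity constant is the distance to the
  boundary of the region.\<close>

lemma spectrum_positive_op:
  fixes A :: "'a :: chilbert_space \<Rightarrow>\<^sub>L 'a"
  assumes "positive_op A"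
  shows "spectrum A \<subseteq> complex_of_real ` {0..norm A}"
proof
  fix z assume z: "z \<in> spectrum A"
  have A: "A \<in> bounded_ops" and Im0: "\<And>x. Im (cinner (A x) x) = 0"
    and pos: "\<And>x. 0 \<le> Re (cinner (A x) x)"
    using assms Im_cinner_self_adjoint unfolding positive_op_def by blast+
  have "Im z = 0"
  proof (rule ccontr)
    assume "Im z \<noteq> 0"
    then show False
      using z not_in_spectrumI[OF A, of "\<bar>Im z\<bar>" "\<i> * sgn (Im z)" z]
      by (simp add: Im0 sgn_if split: if_splits)
  qed
  moreover have "0 \<le> Re z"
  proof (rule ccontr)
    assume "\<not> 0 \<le> Re z"
    then show False
      using z not_in_spectrumI[OF A, of "- Re z" 1 z] by (simp add: pos)
  qed
  moreover have "Re z \<le> norm A"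
  proof (rule ccontr)
    assume neg: "\<not> Re z \<le> norm A"
    have "Re (cinner (A x) x) \<le> norm A * (norm x)\<^sup>2" for x
      using order_trans[OF Re_cinner_le mult_right_mono[OF norm_blinfun norm_ge_zero]]
      by (simp add: power2_eq_square mult_ac)
    then show False
      using z neg not_in_spectrumI[OF A, of "Re z - norm A" "-1" z]
      by (simp add: algebra_simps)
  qed
  ultimately show "z \<in> complex_of_real ` {0..norm A}"
    by (intro image_eqI[of _ _ "Re z"]) (auto simp: complex_eq_iff)
qed

section \<open>Polynomials of an operator\<close>

lemma op_scaleC_zero_left [simp]: "op_scaleC 0 A = 0"
  by (rule blinfun_eqI) (simp add: op_scaleC_apply)

lemma poly_op_0 [simp]: "poly_op 0 A = 0"
  by (simp add: poly_op_def)

context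
  fixes A :: "'a :: chilbert_space \<Rightarrow>\<^sub>L 'a"
  assumes A: "A \<in> bounded_ops"
begin

text \<open>The Horner recursion; it lets the later identities be proved by induction on the
  polynomial instead of with coefficient sums.\<close>

lemma poly_op_pCons: "poly_op (pCons a p) A = op_scaleC a id_blinfun + (A o\<^sub>L poly_op p A)"
proof -
  let ?t = "\<lambda>p i. op_scaleC (coeff p i) (((o\<^sub>L) A ^^ i) id_blinfun)"
  have scale: "A o\<^sub>L op_scaleC c B = op_scaleC c (A o\<^sub>L B)" for c and B :: "'a \<Rightarrow>\<^sub>L 'a"
    by (rule blinfun_eqI) (simp add: op_scaleC_apply bounded_opsD[OF A])
  \<comment> \<open>The sum is padded up to \<open>Suc (degree p)\<close> with zero coefficients, so
    that p = 0, where the degree does not rise, needs no separate case.\<close>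
  have "poly_op (pCons a p) A = (\<Sum>i\<le>Suc (degree p). ?t (pCons a p) i)"
    unfolding poly_op_def
    by (rule sum.mono_neutral_left) (auto simp: coeff_eq_0 degree_pCons_le split: if_splits)
  also have "\<dots> = op_scaleC a id_blinfun + (\<Sum>i\<le>degree p. A o\<^sub>L ?t p i)"
    by (subst sum.atMost_Suc_shift) (simp add: scale)
  also have "(\<Sum>i\<le>degree p. A o\<^sub>L ?t p i) = A o\<^sub>L poly_op p A"
    unfolding poly_op_def by (rule bounded_bilinear.sum_right[OF bounded_bilinear_blinfun_compose, symmetric])
  finally show ?thesis .
qed

lemma poly_op_pCons_apply:
  "blinfun_apply (poly_op (pCons a p) A) x = a *\<^sub>C x + A (blinfun_apply (poly_op p A) x)"
  by (simp add: poly_op_pCons blinfun.add_left op_scaleC_apply)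

lemma poly_op_in_bounded_ops: "poly_op p A \<in> bounded_ops"
  by (induction p)
     (simp_all add: bounded_ops_def poly_op_pCons_apply blinfun.add_right bounded_opsD[OF A]
       scaleC_add_right scaleC_scaleC mult.commute)

lemma poly_op_commute: "A (blinfun_apply (poly_op p A) x) = blinfun_apply (poly_op p A) (A x)"
  by (induction p) (simp_all add: poly_op_pCons_apply blinfun.add_right bounded_opsD[OF A])

lemma poly_op_add: "poly_op (p + q) A = poly_op p A + poly_op q A"
proof (rule blinfun_eqI)
  show "blinfun_apply (poly_op (p + q) A) x = blinfun_apply (poly_op p A + poly_op q A) x" for x
    by (induction p q rule: poly_induct2)
       (simp_all add: poly_op_pCons_apply blinfun.bilinear_simps scaleC_add_left)
qed

lemma poly_op_smult: "poly_op (smult c p) A = op_scaleC c (poly_op p A)"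
proof (rule blinfun_eqI)
  show "blinfun_apply (poly_op (smult c p) A) x = blinfun_apply (op_scaleC c (poly_op p A)) x" for x
    by (induction p)
       (simp_all add: poly_op_pCons_apply op_scaleC_apply scaleC_add_right scaleC_scaleC
         bounded_opsD[OF A])
qed

lemma poly_op_diff: "poly_op (p - q) A = poly_op p A - poly_op q A"
proof -
  have "poly_op p A = poly_op (p - q) A + poly_op q A"
    by (simp flip: poly_op_add)
  then show ?thesis
    by simp
qed

lemma poly_op_mult: "poly_op (p * q) A = poly_op p A o\<^sub>L poly_op q A"
proof (rule blinfun_eqI)
  show "blinfun_apply (poly_op (p * q) A) x = blinfun_apply (poly_op p A o\<^sub>L poly_op q A) x" for x
    by (induction p)
       (simp_all add: mult_pCons_left poly_op_add poly_op_smult blinfun.add_left op_scaleC_apply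
         poly_op_pCons_apply)
qed

text \<open>Conjugating coefficients realises the adjoint of p(A) as another polynomial in A, which
  keeps products such as p(A)* p(A) inside the reach of the factorisation argument.\<close>

lemma cinner_poly_op:
  assumes "\<And>x y. cinner (A x) y = cinner x (A y)"
  shows "cinner (blinfun_apply (poly_op p A) x) y
    = cinner x (blinfun_apply (poly_op (map_poly cnj p) A) y)"
  by (induction p arbitrary: x y)
     (simp_all add: poly_op_pCons_apply map_poly_pCons cinner_algebra assms poly_op_commute)

text \<open>By the fundamental theorem of algebra p splits off a factor \<open>[:- z, 1:]\<close>,
  where z is a root and so lies outside the spectrum. Its inverse B contributes a factor
  \<open>norm B\<close> to the constant, and the quotient is handled by induction on the
  degree.\<close>

lemma poly_op_bounded_below:
  assumes "p \<noteq> 0" and "\<And>z. z \<in> spectrum A \<Longrightarrow> poly p z \<noteq> 0"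
  shows "\<exists>k\<ge>0. \<forall>x. norm x \<le> k * norm (blinfun_apply (poly_op p A) x)"
  using assms
proof (induction "degree p" arbitrary: p rule: less_induct)
  case less
  show ?case
  proof (cases "degree p = 0")
    case True
    then obtain c where p: "p = [:c:]"
      by (rule degree_eq_zeroE)
    with less.prems have "c \<noteq> 0"
      by simp
    then show ?thesis
      by (intro exI[of _ "1 / cmod c"]) (simp add: p poly_op_pCons_apply norm_scaleC)
  next
    case False
    then obtain z where z: "poly p z = 0"
      using fundamental_theorem_of_algebra[of p] by (auto simp: constant_degree)
    then obtain q where q: "p = [:- z, 1:] * q"
      by (auto simp: poly_eq_0_iff_dvd)
    with less.prems have "q \<noteq> 0"
      by auto
    then have "degree q < degree p"
      unfolding q by (subst degree_mult_eq) auto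
    moreover have "poly q w \<noteq> 0" if "w \<in> spectrum A" for w
      using less.prems(2)[OF that] by (simp add: q)
    ultimately obtain k where k: "k \<ge> 0"
      "\<And>x. norm x \<le> k * norm (blinfun_apply (poly_op q A) x)"
      using less.hyps[of q] \<open>q \<noteq> 0\<close> by blast
    have "z \<notin> spectrum A"
      using less.prems(2) z by blast
    then obtain B :: "'a \<Rightarrow>\<^sub>L 'a" where B_inv: "B o\<^sub>L (A - op_scaleC z id_blinfun) = id_blinfun"
      unfolding spectrum_def by blast
    have B: "B (A y - z *\<^sub>C y) = y" for y
      using arg_cong[OF B_inv, of "\<lambda>F. blinfun_apply F y"]
      by (simp add: blinfun.diff_left op_scaleC_apply)
    have p_apply: "blinfun_apply (poly_op p A) x
        = A (blinfun_apply (poly_op q A) x) - z *\<^sub>C blinfun_apply (poly_op q A) x" for x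
    proof -
      have "(- z) *\<^sub>C y = - (z *\<^sub>C y)" for y :: 'a
        using scaleC_add_left[of z "- z" y] by (simp add: eq_neg_iff_add_eq_0 add.commute)
      then show ?thesis
        unfolding q poly_op_mult by (simp add: poly_op_pCons_apply scaleC_one)
    qed
    have "norm x \<le> k * norm B * norm (blinfun_apply (poly_op p A) x)" for x
    proof -
      have "norm (blinfun_apply (poly_op q A) x) \<le> norm B * norm (blinfun_apply (poly_op p A) x)"
        using norm_blinfun[of B "blinfun_apply (poly_op p A) x"] by (simp add: p_apply B)
      then show ?thesis
        using order_trans[OF k(2) mult_left_mono[OF _ k(1)]] by (simp add: mult.assoc)
    qed
    then show ?thesis
      using k(1) by (intro exI[of _ "k * norm B"]) auto
  qed
qed

end

lemma poly_op_intertwine: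
  fixes A B U :: "'a :: chilbert_space \<Rightarrow>\<^sub>L 'a"
  assumes A: "A \<in> bounded_ops" and B: "B \<in> bounded_ops" and U: "U \<in> bounded_ops"
    and "\<And>x. B (U x) = U (A x)"
  shows "blinfun_apply (poly_op p B) (U x) = U (blinfun_apply (poly_op p A) x)"
  by (induction p arbitrary: x)
     (simp_all add: poly_op_pCons_apply[OF A] poly_op_pCons_apply[OF B] blinfun.add_right
       bounded_opsD[OF U] assms(4))

text \<open>C is the adjoint of B. On vectors where B almost attains its norm,
  \<open>C (B x)\<close> is almost \<open>(norm B)\<^sup>2 *\<^sub>R x\<close>. A lower bound would
  turn this into a uniform gap between \<open>norm (B x)\<close> and \<open>norm B * norm x\<close>,
  so that the norm of B would be smaller than itself.\<close>

lemma not_bounded_below_norm_sq: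
  fixes B C :: "'a :: chilbert_space \<Rightarrow>\<^sub>L 'a" and k :: real and x0 :: 'a
  assumes adj: "\<And>x y. cinner (B x) y = cinner x (C y)" and "0 \<le> k" and "x0 \<noteq> 0"
    and below: "\<And>x. norm x \<le> k * norm (C (B x) - (norm B)\<^sup>2 *\<^sub>R x)"
  shows False
proof -
  define N where "N = (norm B)\<^sup>2"
  have le: "(norm x)\<^sup>2 \<le> k\<^sup>2 * N * (N * (norm x)\<^sup>2 - (norm (B x))\<^sup>2)" for x
  proof -
    have "norm (C y) \<le> norm B * norm y" for y
    proof (rule norm_le_via_cinner)
      fix z
      have "cmod (cinner (C y) z) = cmod (cinner (B z) y)"
        unfolding adj by (subst cinner_commute) simp
      also have "\<dots> \<le> norm B * norm z * norm y"
        by (rule order_trans[OF cmod_cinner_le mult_right_mono[OF norm_blinfun norm_ge_zero]])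
      finally show "cmod (cinner (C y) z) \<le> norm B * norm y * norm z"
        by (simp add: mult_ac)
    qed simp
    from power_mono[OF this[of "B x"] norm_ge_zero, of 2]
    have "(norm (C (B x)))\<^sup>2 \<le> N * (norm (B x))\<^sup>2"
      by (simp add: N_def power_mult_distrib)
    moreover have "cinner (C (B x)) x = of_real ((norm (B x))\<^sup>2)"
      by (subst cinner_commute) (simp add: adj[symmetric] cinner_self)
    moreover from this have "(norm (C (B x) - N *\<^sub>R x))\<^sup>2
        = (norm (C (B x)))\<^sup>2 - 2 * (N * (norm (B x))\<^sup>2) + N\<^sup>2 * (norm x)\<^sup>2"
      by (simp add: norm_diff_sq cinner_scaleR_right power_mult_distrib)
    ultimately have "(norm (C (B x) - N *\<^sub>R x))\<^sup>2 \<le> N * (N * (norm x)\<^sup>2 - (norm (B x))\<^sup>2)"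
      by (simp add: power2_eq_square[of N] algebra_simps)
    then have "k\<^sup>2 * (norm (C (B x) - N *\<^sub>R x))\<^sup>2 \<le> k\<^sup>2 * (N * (N * (norm x)\<^sup>2 - (norm (B x))\<^sup>2))"
      by (rule mult_left_mono) simp
    moreover have "(norm x)\<^sup>2 \<le> k\<^sup>2 * (norm (C (B x) - N *\<^sub>R x))\<^sup>2"
      using power_mono[OF below[of x] norm_ge_zero, of 2] by (simp add: N_def power_mult_distrib)
    ultimately show ?thesis
      by (simp add: mult.assoc)
  qed
  have "0 < k\<^sup>2 * N"
  proof (rule ccontr)
    assume "\<not> 0 < k\<^sup>2 * N"
    then have "k\<^sup>2 * N = 0"
      by (metis N_def mult_nonneg_nonneg not_less order_antisym zero_le_power2)
    then have "(norm x0)\<^sup>2 \<le> 0"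
      using le[of x0] by (simp only: mult_zero_left)
    then show False
      using \<open>x0 \<noteq> 0\<close> by simp
  qed
  \<comment> \<open>The gap: dividing \<open>le\<close> by \<open>k\<^sup>2 * N\<close> bounds the
    defect \<open>N * (norm x)\<^sup>2 - (norm (B x))\<^sup>2\<close> below by
    \<open>d * (norm x)\<^sup>2\<close>.\<close>
  define d where "d = 1 / (k\<^sup>2 * N)"
  have "0 < d"
    using \<open>0 < k\<^sup>2 * N\<close> by (simp add: d_def)
  have le': "(norm (B x))\<^sup>2 \<le> (N - d) * (norm x)\<^sup>2" for x
  proof -
    have "d * (norm x)\<^sup>2 \<le> d * (k\<^sup>2 * N * (N * (norm x)\<^sup>2 - (norm (B x))\<^sup>2))"
      using le[of x] \<open>0 < d\<close> by (intro mult_left_mono) auto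
    also have "\<dots> = N * (norm x)\<^sup>2 - (norm (B x))\<^sup>2"
      using \<open>0 < k\<^sup>2 * N\<close> by (auto simp: d_def)
    finally show ?thesis
      by (simp add: algebra_simps)
  qed
  have "0 \<le> (N - d) * (norm x0)\<^sup>2"
    using le'[of x0] zero_le_power2 order_trans by blast
  then have "0 \<le> N - d"
    using \<open>x0 \<noteq> 0\<close> by (simp add: zero_le_mult_iff)
  have "norm B \<le> sqrt (N - d)"
  proof (rule norm_blinfun_bound)
    fix x
    have "(norm (B x))\<^sup>2 \<le> (sqrt (N - d) * norm x)\<^sup>2"
      using le'[of x] \<open>0 \<le> N - d\<close> by (simp add: power_mult_distrib)
    then show "norm (B x) \<le> sqrt (N - d) * norm x"
      by (rule power2_le_imp_le)
         (intro mult_nonneg_nonneg real_sqrt_ge_zero norm_ge_zero \<open>0 \<le> N - d\<close>)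
  qed (use \<open>0 \<le> N - d\<close> in simp)
  from power_mono[OF this norm_ge_zero, of 2] have "N \<le> N - d"
    using \<open>0 \<le> N - d\<close> by (simp add: N_def)
  then show False
    using \<open>0 < d\<close> by simp
qed

section \<open>Norms of polynomials of a positive operator\<close>

lemma positive_op_in_bounded_ops: "positive_op A \<Longrightarrow> A \<in> bounded_ops"
  by (simp add: positive_op_def)

lemma positive_op_symmetric:
  "positive_op A \<Longrightarrow> cinner (blinfun_apply A x) y = cinner x (blinfun_apply A y)"
  by (simp add: positive_op_def)

text \<open>
  With \<open>q = p\<^sup>* p\<close> and \<open>N = \<parallel>p(A)\<parallel>\<^sup>2\<close>, the operator \<open>q(A) - N\<close> is not bounded below, so
  \<open>q - N\<close> has a root in the spectrum.
\<close>

lemma norm_poly_op_attained: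
  fixes A :: "'a :: chilbert_space \<Rightarrow>\<^sub>L 'a" and x0 :: 'a
  assumes A: "positive_op A" and "x0 \<noteq> 0"
  shows "\<exists>z\<in>spectrum A. cmod (poly p z) = norm (poly_op p A)"
proof -
  note bo = positive_op_in_bounded_ops[OF A]
  define s where "s p = map_poly cnj p * p - [:of_real ((norm (poly_op p A))\<^sup>2):]" for p
  have root: "s p = 0 \<or> (\<exists>z\<in>spectrum A. poly (s p) z = 0)" for p
  proof (rule ccontr)
    assume "\<not> ?thesis"
    then obtain k where "0 \<le> k" and k: "\<And>x. norm x \<le> k * norm (blinfun_apply (poly_op (s p) A) x)"
      using poly_op_bounded_below[OF bo, of "s p"] by blast
    have s_apply: "blinfun_apply (poly_op (s p) A) x = blinfun_apply (poly_op (map_poly cnj p) A)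
        (blinfun_apply (poly_op p A) x) - (norm (poly_op p A))\<^sup>2 *\<^sub>R x" for x
      by (simp add: s_def poly_op_diff[OF bo] poly_op_mult[OF bo] poly_op_pCons_apply[OF bo]
          blinfun.diff_left scaleR_scaleC)
    show False
      by (rule not_bounded_below_norm_sq[of "poly_op p A" "poly_op (map_poly cnj p) A",
            OF _ \<open>0 \<le> k\<close> \<open>x0 \<noteq> 0\<close>])
         (simp_all add: cinner_poly_op[OF bo] positive_op_symmetric[OF A] k flip: s_apply)
  qed
  \<comment> \<open>When \<open>s p = 0\<close>, a root is available only if the spectrum has a
    point at all. The polynomial of A itself provides one, since its \<open>s\<close> has degree
    two.\<close>
  have "s [:0, 1:] \<noteq> 0"
    by (simp add: s_def map_poly_pCons)
  with root[of "[:0, 1:]"] have "\<exists>z. z \<in> spectrum A"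
    by blast
  with root[of p] obtain z where z: "z \<in> spectrum A" "poly (s p) z = 0"
    by (metis poly_0)
  have "cnj z = z"
    using z(1) spectrum_positive_op[OF A] by auto
  then have "cnj (poly p z) * poly p z = of_real ((norm (poly_op p A))\<^sup>2)"
    using z(2) by (simp add: s_def)
  then have "(cmod (poly p z))\<^sup>2 = (norm (poly_op p A))\<^sup>2"
    by (simp add: complex_norm_square mult.commute flip: of_real_eq_iff[where 'a = complex] del: of_real_power)
  then show ?thesis
    using z(1) by (auto simp: power2_eq_iff_nonneg)
qed

text \<open>The zero space is treated apart because its operators have empty spectrum, so that no
  value is attained; there every operator is 0.\<close>

lemma norm_poly_op_le:
  fixes A :: "'a :: chilbert_space \<Rightarrow>\<^sub>L 'a"
  assumes A: "positive_op A" and "0 \<le> c" and "\<And>z. z \<in> spectrum A \<Longrightarrow> cmod (poly p z) \<le> c"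
  shows "norm (poly_op p A) \<le> c"
proof (cases "\<exists>x :: 'a. x \<noteq> 0")
  case True
  then show ?thesis
    using norm_poly_op_attained[OF A, of _ p] assms(3) by metis
next
  case False
  then have "poly_op p A = 0"
    by (intro blinfun_eqI) metis
  then show ?thesis
    using \<open>0 \<le> c\<close> by simp
qed

section \<open>The continuous functional calculus of a positive operator\<close>

text \<open>Makes the definite description in \<open>cfc\<close> meaningful: the limit exists by
  completeness and does not depend on the chosen polynomials.\<close>

lemma cfc_tendsto:
  fixes A :: "'a :: chilbert_space \<Rightarrow>\<^sub>L 'a"
  assumes A: "positive_op A" and p: "uniform_limit (spectrum A) (\<lambda>n z. poly (p n) z) f sequentially"
  shows "(\<lambda>n. poly_op (p n) A) \<longlonglongrightarrow> cfc f A"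
proof -
  note bo = positive_op_in_bounded_ops[OF A]
  \<comment> \<open>Stated for two sequences so that it serves twice: with equal ones for the Cauchy
    property, with different ones for uniqueness of the limit.\<close>
  have close: "\<exists>N. \<forall>m\<ge>N. \<forall>n\<ge>N. norm (poly_op (q m) A - poly_op (q' n) A) < e"
    if "0 < e" and q: "uniform_limit (spectrum A) (\<lambda>n z. poly (q n) z) f sequentially"
      "uniform_limit (spectrum A) (\<lambda>n z. poly (q' n) z) f sequentially" for e q q'
  proof -
    have "0 < e / 3"
      using \<open>0 < e\<close> by simp
    obtain N where N: "\<And>n z. n \<ge> N \<Longrightarrow> z \<in> spectrum A \<Longrightarrow> dist (poly (q n) z) (f z) < e / 3"
      using uniform_limitD[OF q(1) \<open>0 < e / 3\<close>] by (auto simp: eventually_sequentially)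
    obtain N' where N': "\<And>n z. n \<ge> N' \<Longrightarrow> z \<in> spectrum A \<Longrightarrow> dist (poly (q' n) z) (f z) < e / 3"
      using uniform_limitD[OF q(2) \<open>0 < e / 3\<close>] by (auto simp: eventually_sequentially)
    have "norm (poly_op (q m) A - poly_op (q' n) A) < e" if "m \<ge> max N N'" "n \<ge> max N N'" for m n
    proof -
      have "norm (poly_op (q m - q' n) A) \<le> 2 * (e / 3)"
      proof (rule norm_poly_op_le[OF A])
        fix z assume "z \<in> spectrum A"
        then have "dist (poly (q m) z) (poly (q' n) z) < e / 3 + e / 3"
          using N[of m z] N'[of n z] that by (intro dist_triangle_less_add) auto
        then show "cmod (poly (q m - q' n) z) \<le> 2 * (e / 3)"
          by (simp add: dist_norm)
      qed (use \<open>0 < e\<close> in simp)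
      then show ?thesis
        using \<open>0 < e\<close> by (simp add: poly_op_diff[OF bo])
    qed
    then show ?thesis
      by blast
  qed
  have "Cauchy (\<lambda>n. poly_op (p n) A)"
    using close[OF _ p p] by (intro CauchyI) blast
  then obtain B where B: "(\<lambda>n. poly_op (p n) A) \<longlonglongrightarrow> B"
    using Cauchy_convergent_iff convergent_def by blast
  have "cfc f A = B"
    unfolding cfc_def
  proof (rule the_equality)
    show "\<exists>p. uniform_limit (spectrum A) (\<lambda>n z. poly (p n) z) f sequentially
        \<and> (\<lambda>n. poly_op (p n) A) \<longlonglongrightarrow> B"
      using p B by blast
    fix C assume "\<exists>p. uniform_limit (spectrum A) (\<lambda>n z. poly (p n) z) f sequentially
        \<and> (\<lambda>n. poly_op (p n) A) \<longlonglongrightarrow> C"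
    then obtain q where q: "uniform_limit (spectrum A) (\<lambda>n z. poly (q n) z) f sequentially"
      and C: "(\<lambda>n. poly_op (q n) A) \<longlonglongrightarrow> C"
      by blast
    have "(\<lambda>n. poly_op (q n) A - poly_op (p n) A) \<longlonglongrightarrow> 0"
    proof (rule LIMSEQ_I)
      fix e :: real assume "0 < e"
      from close[OF this q p]
      show "\<exists>N. \<forall>n\<ge>N. norm (poly_op (q n) A - poly_op (p n) A - 0) < e"
        by auto
    qed
    moreover have "(\<lambda>n. poly_op (q n) A - poly_op (p n) A) \<longlonglongrightarrow> C - B"
      by (intro tendsto_diff C B)
    ultimately show "C = B"
      using LIMSEQ_unique by fastforce
  qed
  with B show ?thesis
    by simp
qed

section \<open>The calculus for real functions on the half-line\<close>

lemma poly_map_poly_of_real: "poly (map_poly of_real r) (complex_of_real x) = of_real (poly r x)"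
  by (induction r) (simp_all add: map_poly_pCons)

lemma map_poly_cnj_of_real: "map_poly cnj (map_poly complex_of_real r) = map_poly complex_of_real r"
  by (rule poly_eqI) (simp add: coeff_map_poly)

definition rcfc :: "(real \<Rightarrow> real) \<Rightarrow> ('a :: chilbert_space \<Rightarrow>\<^sub>L 'a) \<Rightarrow> ('a \<Rightarrow>\<^sub>L 'a)" where
  "rcfc g A = cfc (\<lambda>z. of_real (g (Re z))) A"

definition rpoly_op :: "real poly \<Rightarrow> ('a :: chilbert_space \<Rightarrow>\<^sub>L 'a) \<Rightarrow> ('a \<Rightarrow>\<^sub>L 'a)" where
  "rpoly_op r A = poly_op (map_poly of_real r) A"

text \<open>The interval may exceed \<open>{0..norm A}\<close>, so that one sequence of polynomials
  can serve two operators at once.\<close>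

lemma rcfc_tendsto:
  fixes A :: "'a :: chilbert_space \<Rightarrow>\<^sub>L 'a"
  assumes A: "positive_op A" and r: "uniform_limit {0..M} (\<lambda>n x. poly (r n) x) g sequentially"
    and M: "norm A \<le> M"
  shows "(\<lambda>n. rpoly_op (r n) A) \<longlonglongrightarrow> rcfc g A"
  unfolding rcfc_def rpoly_op_def
proof (rule cfc_tendsto[OF A], rule uniform_limitI)
  fix e :: real assume "0 < e"
  from uniform_limitD[OF r this]
  show "\<forall>\<^sub>F n in sequentially. \<forall>z\<in>spectrum A.
      dist (poly (map_poly of_real (r n)) z) (of_real (g (Re z))) < e"
  proof eventually_elim
    case (elim n)
    show ?case
    proof
      fix z assume "z \<in> spectrum A"
      then obtain x where "z = of_real x" "x \<in> {0..M}"
        using spectrum_positive_op[OF A] M by force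
      with elim show "dist (poly (map_poly of_real (r n)) z) (of_real (g (Re z))) < e"
        by (simp add: poly_map_poly_of_real dist_of_real)
    qed
  qed
qed

lemma uniform_poly_approximation:
  fixes g :: "real \<Rightarrow> real"
  assumes "continuous_on {0..} g"
  shows "\<exists>r. uniform_limit {0..M} (\<lambda>n x. poly (r n) x) g sequentially"
proof -
  have cont: "continuous_on {0..M} g"
    by (rule continuous_on_subset[OF assms]) auto
  have "\<exists>r. \<forall>x\<in>{0..M}. \<bar>g x - poly r x\<bar> < 1 / Suc n" for n
  proof -
    obtain h where h: "real_polynomial_function h" "\<And>x. x \<in> {0..M} \<Longrightarrow> \<bar>g x - h x\<bar> < 1 / Suc n"
      using Stone_Weierstrass_real_polynomial_function[OF compact_Icc cont, of "1 / Suc n"] by auto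
    then obtain a m where "h = (\<lambda>x. \<Sum>i\<le>m. a i * x ^ i)"
      using real_polynomial_function_iff_sum by blast
    then have "h = poly (\<Sum>i\<le>m. monom (a i) i)"
      by (auto simp: poly_sum poly_monom)
    with h(2) show ?thesis
      by blast
  qed
  then obtain r where r: "\<And>n x. x \<in> {0..M} \<Longrightarrow> \<bar>g x - poly (r n) x\<bar> < 1 / Suc n"
    by metis
  have "uniform_limit {0..M} (\<lambda>n x. poly (r n) x) g sequentially"
  proof (rule uniform_limitI)
    fix e :: real assume "0 < e"
    then obtain N where N: "1 / Suc N < e"
      using reals_Archimedean by (auto simp: inverse_eq_divide)
    have "dist (poly (r n) x) (g x) < e" if "n \<ge> N" "x \<in> {0..M}" for n x
      using r[OF that(2), of n] N frac_le[of 1 1 "Suc N" "Suc n"] that(1)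
      by (simp add: dist_real_def abs_minus_commute)
    then show "\<forall>\<^sub>F n in sequentially. \<forall>x\<in>{0..M}. dist (poly (r n) x) (g x) < e"
      unfolding eventually_sequentially by blast
  qed
  then show ?thesis
    by blast
qed

lemma blinfun_tendsto_apply:
  "(\<lambda>n. blinfun_apply (F n) x) \<longlonglongrightarrow> blinfun_apply G x" if "F \<longlonglongrightarrow> G"
  using that by (intro tendsto_intros)

lemma bounded_ops_limit:
  assumes "F \<longlonglongrightarrow> G" and "\<And>n. F n \<in> bounded_ops"
  shows "G \<in> bounded_ops"
proof -
  have "blinfun_apply G (c *\<^sub>C x) = c *\<^sub>C blinfun_apply G x" for c x
  proof (rule LIMSEQ_unique)
    show "(\<lambda>n. blinfun_apply (F n) (c *\<^sub>C x)) \<longlonglongrightarrow> blinfun_apply G (c *\<^sub>C x)"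
      by (rule blinfun_tendsto_apply[OF assms(1)])
    show "(\<lambda>n. blinfun_apply (F n) (c *\<^sub>C x)) \<longlonglongrightarrow> c *\<^sub>C blinfun_apply G x"
      unfolding bounded_opsD[OF assms(2)]
      by (rule bounded_linear.tendsto[OF bounded_linear_scaleC blinfun_tendsto_apply[OF assms(1)]])
  qed
  then show ?thesis
    by (simp add: bounded_ops_def)
qed

text \<open>For a polynomial, BU = UA can be applied power by power. Approximating g on an interval
  that covers both spectra carries the relation to the limit.\<close>

lemma rcfc_intertwine:
  fixes A B U :: "'a :: chilbert_space \<Rightarrow>\<^sub>L 'a"
  assumes A: "positive_op A" and B: "positive_op B" and U: "U \<in> bounded_ops"
    and BU: "\<And>x. B (U x) = U (A x)" and g: "continuous_on {0..} g"
  shows "blinfun_apply (rcfc g B) (U x) = U (blinfun_apply (rcfc g A) x)"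
proof -
  obtain r where r: "uniform_limit {0..max (norm A) (norm B)} (\<lambda>n x. poly (r n) x) g sequentially"
    using uniform_poly_approximation[OF g] by blast
  have "(\<lambda>n. blinfun_apply (rpoly_op (r n) B) (U x)) \<longlonglongrightarrow> blinfun_apply (rcfc g B) (U x)"
    by (intro blinfun_tendsto_apply rcfc_tendsto[OF B r]) simp
  moreover have "(\<lambda>n. U (blinfun_apply (rpoly_op (r n) A) x)) \<longlonglongrightarrow> U (blinfun_apply (rcfc g A) x)"
    by (intro blinfun.tendsto tendsto_const rcfc_tendsto[OF A r]) simp
  moreover have "blinfun_apply (rpoly_op p B) (U x) = U (blinfun_apply (rpoly_op p A) x)" for p
    unfolding rpoly_op_def
    by (rule poly_op_intertwine[OF positive_op_in_bounded_ops[OF A]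
          positive_op_in_bounded_ops[OF B] U BU])
  ultimately show ?thesis
    using LIMSEQ_unique by simp
qed

context
  fixes A :: "'a :: chilbert_space \<Rightarrow>\<^sub>L 'a"
  assumes A: "positive_op A"
begin

lemma rcfc_approx:
  assumes "continuous_on {0..} g"
  obtains r where "uniform_limit {0..norm A} (\<lambda>n x. poly (r n) x) g sequentially"
    "(\<lambda>n. rpoly_op (r n) A) \<longlonglongrightarrow> rcfc g A"
  using uniform_poly_approximation[OF assms] rcfc_tendsto[OF A _ order_refl] by blast

lemma rcfc_in_bounded_ops:
  assumes "continuous_on {0..} g"
  shows "rcfc g A \<in> bounded_ops"
proof -
  obtain r where "(\<lambda>n. rpoly_op (r n) A) \<longlonglongrightarrow> rcfc g A"
    using rcfc_approx[OF assms] .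
  then show ?thesis
    by (rule bounded_ops_limit)
       (simp add: rpoly_op_def poly_op_in_bounded_ops positive_op_in_bounded_ops[OF A])
qed

text \<open>The approximating polynomials have real coefficients, so conjugation leaves them fixed
  and each approximant is symmetric.\<close>

lemma rcfc_symmetric:
  assumes "continuous_on {0..} g"
  shows "cinner (blinfun_apply (rcfc g A) x) y = cinner x (blinfun_apply (rcfc g A) y)"
proof -
  obtain r where r: "(\<lambda>n. rpoly_op (r n) A) \<longlonglongrightarrow> rcfc g A"
    using rcfc_approx[OF assms] .
  have "cinner (blinfun_apply (rpoly_op p A) x) y = cinner x (blinfun_apply (rpoly_op p A) y)" for p
    by (simp add: rpoly_op_def cinner_poly_op positive_op_in_bounded_ops[OF A]
        positive_op_symmetric[OF A] map_poly_cnj_of_real)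
  then show ?thesis
    using tendsto_cinner[OF blinfun_tendsto_apply[OF r, of x] tendsto_const[of y]]
      tendsto_cinner[OF tendsto_const[of x] blinfun_tendsto_apply[OF r, of y]]
      LIMSEQ_unique by simp
qed

lemma rcfc_cong:
  assumes "continuous_on {0..} g" and "\<And>x. 0 \<le> x \<Longrightarrow> g x = h x"
  shows "rcfc g A = rcfc h A"
proof -
  obtain r where r: "uniform_limit {0..norm A} (\<lambda>n x. poly (r n) x) g sequentially"
    "(\<lambda>n. rpoly_op (r n) A) \<longlonglongrightarrow> rcfc g A"
    using rcfc_approx[OF assms(1)] .
  have "uniform_limit {0..norm A} (\<lambda>n x. poly (r n) x) h sequentially"
    using r(1) by (subst uniform_limit_cong'[OF refl, of _ h g]) (simp_all add: assms(2))
  from rcfc_tendsto[OF A this order_refl] r(2) show ?thesis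
    using LIMSEQ_unique by blast
qed

lemma rcfc_id: "rcfc (\<lambda>x. x) A = A"
proof -
  have "rpoly_op [:0, 1:] A = A"
    by (rule blinfun_eqI)
       (simp add: rpoly_op_def map_poly_pCons poly_op_pCons_apply positive_op_in_bounded_ops[OF A]
         scaleC_one)
  moreover have "uniform_limit {0..norm A} (\<lambda>n x. poly [:0, 1:] x) (\<lambda>x. x) sequentially"
    by (simp add: uniform_limit_const)
  from rcfc_tendsto[OF A this order_refl] have "rpoly_op [:0, 1:] A = rcfc (\<lambda>x. x) A"
    by (simp only: LIMSEQ_const_iff)
  ultimately show ?thesis
    by simp
qed

lemma rcfc_diff:
  assumes "continuous_on {0..} g" and "continuous_on {0..} h"
  shows "rcfc (\<lambda>x. g x - h x) A = rcfc g A - rcfc h A"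
proof -
  obtain r where r: "uniform_limit {0..norm A} (\<lambda>n x. poly (r n) x) g sequentially"
    "(\<lambda>n. rpoly_op (r n) A) \<longlonglongrightarrow> rcfc g A"
    using rcfc_approx[OF assms(1)] .
  obtain q where q: "uniform_limit {0..norm A} (\<lambda>n x. poly (q n) x) h sequentially"
    "(\<lambda>n. rpoly_op (q n) A) \<longlonglongrightarrow> rcfc h A"
    using rcfc_approx[OF assms(2)] .
  have "uniform_limit {0..norm A} (\<lambda>n x. poly (r n - q n) x) (\<lambda>x. g x - h x) sequentially"
    using uniform_limit_minus[OF r(1) q(1)] by simp
  from rcfc_tendsto[OF A this order_refl]
  have "(\<lambda>n. rpoly_op (r n - q n) A) \<longlonglongrightarrow> rcfc (\<lambda>x. g x - h x) A" .
  moreover have "rpoly_op (r n - q n) A = rpoly_op (r n) A - rpoly_op (q n) A" for n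
  proof -
    have "map_poly complex_of_real (r n - q n) = map_poly of_real (r n) - map_poly of_real (q n)"
      by (rule poly_eqI) (simp add: coeff_map_poly)
    then show ?thesis
      by (simp add: rpoly_op_def poly_op_diff positive_op_in_bounded_ops[OF A])
  qed
  ultimately show ?thesis
    using tendsto_diff[OF r(2) q(2)] LIMSEQ_unique by simp
qed

lemma rcfc_mult:
  assumes g: "continuous_on {0..} g" and h: "continuous_on {0..} h"
  shows "rcfc (\<lambda>x. g x * h x) A = rcfc g A o\<^sub>L rcfc h A"
proof -
  obtain r where r: "uniform_limit {0..norm A} (\<lambda>n x. poly (r n) x) g sequentially"
    "(\<lambda>n. rpoly_op (r n) A) \<longlonglongrightarrow> rcfc g A"
    using rcfc_approx[OF g] .
  obtain q where q: "uniform_limit {0..norm A} (\<lambda>n x. poly (q n) x) h sequentially"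
    "(\<lambda>n. rpoly_op (q n) A) \<longlonglongrightarrow> rcfc h A"
    using rcfc_approx[OF h] .
  have bdd: "bounded (f ` {0..norm A})" if "continuous_on {0..} f" for f :: "real \<Rightarrow> real"
    by (intro compact_imp_bounded compact_continuous_image continuous_on_subset[OF that]) auto
  have "uniform_limit {0..norm A} (\<lambda>n x. poly (r n * q n) x) (\<lambda>x. g x * h x) sequentially"
    using uniform_lim_mult[OF r(1) q(1) bdd[OF g] bdd[OF h]] by simp
  from rcfc_tendsto[OF A this order_refl]
  have "(\<lambda>n. rpoly_op (r n * q n) A) \<longlonglongrightarrow> rcfc (\<lambda>x. g x * h x) A" .
  moreover have "rpoly_op (r n * q n) A = rpoly_op (r n) A o\<^sub>L rpoly_op (q n) A" for n
  proof -
    have "map_poly complex_of_real (r n * q n) = map_poly of_real (r n) * map_poly of_real (q n)"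
      by (rule poly_eqI) (simp add: coeff_map_poly coeff_mult)
    then show ?thesis
      by (simp add: rpoly_op_def poly_op_mult positive_op_in_bounded_ops[OF A])
  qed
  ultimately show ?thesis
    using bounded_bilinear.tendsto[OF bounded_bilinear_blinfun_compose r(2) q(2)] LIMSEQ_unique by simp
qed

lemma norm_rcfc_le:
  assumes "continuous_on {0..} g" and "0 \<le> c" and c: "\<And>x. 0 \<le> x \<Longrightarrow> x \<le> norm A \<Longrightarrow> \<bar>g x\<bar> \<le> c"
  shows "norm (rcfc g A) \<le> c"
proof (rule field_le_epsilon)
  fix e :: real assume "0 < e"
  obtain r where r: "uniform_limit {0..norm A} (\<lambda>n x. poly (r n) x) g sequentially"
    "(\<lambda>n. rpoly_op (r n) A) \<longlonglongrightarrow> rcfc g A"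
    using rcfc_approx[OF assms(1)] .
  have "\<forall>\<^sub>F n in sequentially. norm (rpoly_op (r n) A) \<le> c + e"
    using uniform_limitD[OF r(1) \<open>0 < e\<close>]
  proof eventually_elim
    case (elim n)
    show ?case
      unfolding rpoly_op_def
    proof (rule norm_poly_op_le[OF A])
      fix z assume "z \<in> spectrum A"
      then obtain x where x: "z = of_real x" "x \<in> {0..norm A}"
        using spectrum_positive_op[OF A] by blast
      then have "\<bar>poly (r n) x - g x\<bar> < e" "\<bar>g x\<bar> \<le> c"
        using elim c by (auto simp: dist_real_def)
      then show "cmod (poly (map_poly of_real (r n)) z) \<le> c + e"
        by (simp add: x(1) poly_map_poly_of_real)
    qed (use \<open>0 < e\<close> \<open>0 \<le> c\<close> in simp)
  qed
  then show "norm (rcfc g A) \<le> c + e"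
    by (rule tendsto_upperbound[OF tendsto_norm[OF r(2)]]) simp
qed

text \<open>g(A) is the square of the symmetric operator obtained from the square root of g, so its
  quadratic form is a squared norm.\<close>

lemma positive_op_rcfc:
  assumes g: "continuous_on {0..} g" and "\<And>x. 0 \<le> x \<Longrightarrow> 0 \<le> g x"
  shows "positive_op (rcfc g A)"
proof -
  have cont: "continuous_on {0..} (\<lambda>x. sqrt (g x))"
    by (intro continuous_intros g)
  have "rcfc g A = rcfc (\<lambda>x. sqrt (g x) * sqrt (g x)) A"
    using assms by (intro rcfc_cong) auto
  also have "\<dots> = rcfc (\<lambda>x. sqrt (g x)) A o\<^sub>L rcfc (\<lambda>x. sqrt (g x)) A"
    by (rule rcfc_mult[OF cont cont])
  finally have "blinfun_apply (rcfc g A) x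
      = blinfun_apply (rcfc (\<lambda>x. sqrt (g x)) A) (blinfun_apply (rcfc (\<lambda>x. sqrt (g x)) A) x)" for x
    by simp
  then have "0 \<le> Re (cinner (blinfun_apply (rcfc g A) x) x)" for x
    by (simp add: rcfc_symmetric[OF cont] cinner_self)
  then show ?thesis
    by (simp add: positive_op_def rcfc_in_bounded_ops[OF g] rcfc_symmetric[OF g])
qed

end

section \<open>Powers of positive operators\<close>

lemma rpow_nonneg: "0 \<le> rpow x s"
  by (simp add: rpow_def)

lemma rpow_1: "0 \<le> x \<Longrightarrow> rpow x 1 = x"
  by (simp add: rpow_def)

lemma rpow_add: "0 \<le> s \<Longrightarrow> 0 \<le> r \<Longrightarrow> rpow x (s + r) = rpow x s * rpow x r"
  by (simp add: rpow_def powr_add add_nonneg_eq_0_iff)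

lemma rpow_mono: "0 \<le> s \<Longrightarrow> 0 \<le> x \<Longrightarrow> x \<le> y \<Longrightarrow> rpow x s \<le> rpow y s"
  by (simp add: rpow_def powr_mono2)

text \<open>The convention for exponent 0 matters here: \<open>powr\<close> would jump at the
  origin, whereas \<open>rpow\<close> is constantly 1.\<close>

lemma continuous_on_rpow: "0 \<le> s \<Longrightarrow> continuous_on {0..} (\<lambda>x. rpow x s)"
proof (cases "s = 0")
  case False
  assume "0 \<le> s"
  with False have "continuous_on {0..} (\<lambda>x. x powr s)"
    by (intro continuous_on_powr' continuous_on_id continuous_on_const) auto
  with False show ?thesis
    by (simp add: rpow_def)
qed (simp add: rpow_def)

lemma op_pow_eq_rcfc: "op_pow A s = rcfc (\<lambda>x. rpow x s) A"
  by (simp add: op_pow_def rcfc_def)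

lemma op_pow_intertwine:
  fixes A B U :: "'a :: chilbert_space \<Rightarrow>\<^sub>L 'a"
  assumes "positive_op A" and "positive_op B" and "U \<in> bounded_ops"
    and "\<And>x. B (U x) = U (A x)" and "0 \<le> s"
  shows "blinfun_apply (op_pow B s) (U x) = U (blinfun_apply (op_pow A s) x)"
  unfolding op_pow_eq_rcfc by (rule rcfc_intertwine[OF assms(1-4) continuous_on_rpow[OF assms(5)]])

context
  fixes A :: "'a :: chilbert_space \<Rightarrow>\<^sub>L 'a"
  assumes A: "positive_op A"
begin

lemma op_pow_1: "op_pow A 1 = A"
proof -
  have "rcfc (\<lambda>x. rpow x 1) A = rcfc (\<lambda>x. x) A"
    by (intro rcfc_cong A continuous_on_rpow) (simp_all add: rpow_1)
  then show ?thesis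
    by (simp add: op_pow_eq_rcfc rcfc_id[OF A])
qed

lemma op_pow_add:
  assumes "0 \<le> s" and "0 \<le> r"
  shows "op_pow A (s + r) = op_pow A s o\<^sub>L op_pow A r"
  unfolding op_pow_eq_rcfc rpow_add[OF assms]
  by (rule rcfc_mult[OF A continuous_on_rpow[OF assms(1)] continuous_on_rpow[OF assms(2)]])

lemma positive_op_op_pow: "0 \<le> s \<Longrightarrow> positive_op (op_pow A s)"
  unfolding op_pow_eq_rcfc by (intro positive_op_rcfc A continuous_on_rpow rpow_nonneg)

lemma norm_op_pow_le: "0 \<le> s \<Longrightarrow> norm (op_pow A s) \<le> rpow (norm A) s"
  unfolding op_pow_eq_rcfc
  by (intro norm_rcfc_le A continuous_on_rpow rpow_nonneg) (simp_all add: rpow_nonneg rpow_mono)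

lemma norm_op_pow_sq:
  assumes "0 \<le> s"
  shows "(norm (blinfun_apply (op_pow A s) x))\<^sup>2 = Re (cinner (blinfun_apply (op_pow A (2 * s)) x) x)"
proof -
  have "blinfun_apply (op_pow A (2 * s)) x = blinfun_apply (op_pow A s) (blinfun_apply (op_pow A s) x)"
    using op_pow_add[OF assms assms] by (simp flip: mult_2)
  then show ?thesis
    by (simp only: positive_op_symmetric[OF positive_op_op_pow[OF assms], of "blinfun_apply _ _"]
        Re_cinner_self)
qed

lemma cinner_split_op_pow:
  assumes "0 \<le> s" and "0 \<le> r" and "s + r = 1"
  shows "cinner (A x) y = cinner (blinfun_apply (op_pow A r) x) (blinfun_apply (op_pow A s) y)"
proof -
  have "A x = blinfun_apply (op_pow A s) (blinfun_apply (op_pow A r) x)"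
    unfolding blinfun_apply_blinfun_compose[symmetric] op_pow_add[OF assms(1,2), symmetric] assms(3)
    by (simp add: op_pow_1)
  then show ?thesis
    by (simp add: positive_op_symmetric[OF positive_op_op_pow[OF assms(1)]])
qed

text \<open>Positivity of \<open>g - g * g\<close> on the half-line. For g a difference of two
  approximate projections, this turns control of quadratic forms into control of vectors.\<close>

lemma norm_rcfc_sq_le:
  assumes g: "continuous_on {0..} g" and "\<And>x. 0 \<le> x \<Longrightarrow> 0 \<le> g x \<and> g x \<le> 1"
  shows "(norm (blinfun_apply (rcfc g A) x))\<^sup>2 \<le> Re (cinner (blinfun_apply (rcfc g A) x) x)"
proof -
  have gg: "continuous_on {0..} (\<lambda>x. g x * g x)"
    by (intro continuous_intros g)
  have "positive_op (rcfc (\<lambda>x. g x - g x * g x) A)"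
    by (intro positive_op_rcfc A continuous_intros g) (simp add: assms(2) mult_left_le)
  then have "0 \<le> Re (cinner (blinfun_apply (rcfc (\<lambda>x. g x - g x * g x) A) x) x)"
    unfolding positive_op_def by blast
  moreover have "cinner (blinfun_apply (rcfc g A) (blinfun_apply (rcfc g A) x)) x
      = of_real ((norm (blinfun_apply (rcfc g A) x))\<^sup>2)"
    by (subst rcfc_symmetric[OF A g]) (rule cinner_self)
  ultimately show ?thesis
    by (simp add: rcfc_diff[OF A g gg] rcfc_mult[OF A g g] blinfun.diff_left cinner_diff_left
        del: of_real_power)
qed

end

section \<open>The polar decomposition\<close>

text \<open>
  The partial isometry is the strong limit of \<open>T (\<bar>T\<bar> + \<epsilon>)\<^sup>-\<^sup>1\<close> as \<open>\<epsilon> \<rightarrow> 0\<close>; the operators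
  \<open>\<bar>T\<bar> (\<bar>T\<bar> + \<epsilon>)\<^sup>-\<^sup>1\<close> increase to the projection onto the closure of the range of \<open>\<bar>T\<bar>\<close>.
\<close>

definition reg_inv :: "nat \<Rightarrow> real \<Rightarrow> real" where
  "reg_inv n x = 1 / (x + 1 / real (Suc n))"

lemma continuous_on_reg_inv: "continuous_on {0..} (reg_inv n)"
proof -
  have "x + 1 / real (Suc n) \<noteq> 0" if "0 \<le> x" for x :: real
    using that by (simp add: add_nonneg_eq_0_iff)
  then show ?thesis
    unfolding reg_inv_def by (intro continuous_intros) auto
qed

lemma continuous_on_mult_reg_inv: "continuous_on {0..} (\<lambda>x. x * reg_inv n x)"
  by (intro continuous_intros continuous_on_reg_inv)

lemma mult_reg_inv_bounds:
  assumes "0 \<le> x"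
  shows "0 \<le> x * reg_inv n x \<and> x * reg_inv n x \<le> 1"
proof -
  have "0 < x + 1 / real (Suc n)"
    using assms by (simp add: add_nonneg_pos)
  then show ?thesis
    using assms by (simp add: reg_inv_def divide_le_eq_1 zero_le_divide_iff)
qed

lemma mult_reg_inv_mono:
  assumes "m \<le> n" and "0 \<le> x"
  shows "x * reg_inv m x \<le> x * reg_inv n x"
proof -
  have "1 / real (Suc n) \<le> 1 / real (Suc m)"
    using \<open>m \<le> n\<close> by (simp add: frac_le)
  moreover have "0 < x + 1 / real (Suc n)"
    using \<open>0 \<le> x\<close> by (simp add: add_nonneg_pos)
  ultimately have "reg_inv m x \<le> reg_inv n x"
    unfolding reg_inv_def by (intro divide_left_mono) (auto intro!: mult_pos_pos)
  then show ?thesis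
    using \<open>0 \<le> x\<close> by (rule mult_left_mono)
qed

lemma mult_reg_inv_error:
  assumes "0 \<le> x"
  shows "\<bar>x * (x * reg_inv n x) - x\<bar> \<le> 1 / real (Suc n)"
proof -
  define e where "e = 1 / real (Suc n)"
  have "0 < e"
    by (simp add: e_def)
  \<comment> \<open>From x / (x + e) = 1 - e / (x + e): the error is e times a quantity between 0
    and 1.\<close>
  then have "x * (x * reg_inv n x) - x = - (e * (x * reg_inv n x))"
    using assms unfolding reg_inv_def e_def[symmetric] by (simp add: field_simps)
  moreover have "0 \<le> e * (x * reg_inv n x)"
    by (rule mult_nonneg_nonneg) (use mult_reg_inv_bounds[OF assms, of n] \<open>0 < e\<close> in simp_all)
  ultimately have "\<bar>x * (x * reg_inv n x) - x\<bar> = e * (x * reg_inv n x)"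
    by linarith
  also have "\<dots> \<le> e"
    using mult_reg_inv_bounds[OF assms, of n] \<open>0 < e\<close> by (intro mult_left_le) auto
  finally show ?thesis
    by (simp add: e_def)
qed

lemma positive_op_adj_comp:
  assumes "A \<in> bounded_ops"
  shows "positive_op (adj A o\<^sub>L A)"
  using adj_in_bounded_ops[OF assms] assms
  by (simp add: positive_op_def bounded_ops_def cinner_adj_left[OF assms]
      cinner_adj_right[OF assms] Re_cinner_self flip: cinner_adj_right[OF assms])

context
  fixes T :: "'a :: chilbert_space \<Rightarrow>\<^sub>L 'a"
  assumes T: "T \<in> bounded_ops"
begin

lemma positive_op_abs: "positive_op (op_abs T)"
  unfolding op_abs_def by (rule positive_op_op_pow[OF positive_op_adj_comp[OF T]]) simp

lemma op_abs_op_abs: "op_abs T (blinfun_apply (op_abs T) x) = adj T (T x)"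
  using op_pow_add[OF positive_op_adj_comp[OF T], of "1 / 2" "1 / 2"]
  by (simp add: op_abs_def op_pow_1[OF positive_op_adj_comp[OF T]] flip: blinfun_apply_blinfun_compose)

lemma norm_op_abs_apply: "norm (op_abs T x) = norm (T x)"
proof -
  have "cinner (op_abs T x) (op_abs T x) = cinner (T x) (T x)"
    unfolding positive_op_symmetric[OF positive_op_abs]
    by (simp add: op_abs_op_abs cinner_adj_right[OF T])
  then show ?thesis
    by (simp add: cinner_self power2_eq_iff_nonneg del: of_real_power)
qed

lemma norm_op_abs_le: "norm (op_abs T) \<le> norm T"
  by (rule norm_blinfun_bound) (simp_all add: norm_op_abs_apply norm_blinfun)

text \<open>By associativity T intertwines \<open>adj T o\<^sub>L T\<close> with
  \<open>T o\<^sub>L adj T\<close>, and their square roots inherit the relation.\<close>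

lemma op_abs_adj_intertwine: "op_abs (adj T) (T x) = T (op_abs T x)"
proof -
  have "positive_op (T o\<^sub>L adj T)"
    using positive_op_adj_comp[OF adj_in_bounded_ops[OF T]] by (simp add: adj_adj[OF T])
  then show ?thesis
    unfolding op_abs_def adj_adj[OF T]
    by (intro op_pow_intertwine positive_op_adj_comp T) simp_all
qed

section \<open>Approximate inverses and the support projection\<close>

abbreviation approx_inv :: "nat \<Rightarrow> ('a \<Rightarrow>\<^sub>L 'a)" where
  "approx_inv n \<equiv> rcfc (reg_inv n) (op_abs T)"

abbreviation approx_proj :: "nat \<Rightarrow> ('a \<Rightarrow>\<^sub>L 'a)" where
  "approx_proj n \<equiv> rcfc (\<lambda>x. x * reg_inv n x) (op_abs T)"

lemma approx_proj_eq: "approx_proj n = op_abs T o\<^sub>L approx_inv n"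
  using rcfc_mult[OF positive_op_abs continuous_on_id continuous_on_reg_inv]
  by (simp add: rcfc_id[OF positive_op_abs])

lemma norm_approx_proj_apply: "norm (blinfun_apply (approx_proj n) x) \<le> norm x"
proof -
  have "norm (approx_proj n) \<le> 1"
    by (rule norm_rcfc_le[OF positive_op_abs continuous_on_mult_reg_inv])
       (use mult_reg_inv_bounds in simp_all)
  then show ?thesis
    using norm_blinfun[of "approx_proj n" x] mult_right_mono[of _ 1 "norm x"] by fastforce
qed

lemma norm_op_abs_approx_proj:
  "norm (op_abs T (blinfun_apply (approx_proj n) x) - op_abs T x) \<le> 1 / real (Suc n) * norm x"
proof -
  let ?g = "\<lambda>x. x * (x * reg_inv n x) - x"
  have cont: "continuous_on {0..} (\<lambda>x. x * (x * reg_inv n x))"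
    by (intro continuous_intros continuous_on_reg_inv)
  have "norm (rcfc ?g (op_abs T)) \<le> 1 / real (Suc n)"
    by (rule norm_rcfc_le[OF positive_op_abs])
       (use mult_reg_inv_error cont in \<open>auto intro!: continuous_intros\<close>)
  then have "norm (blinfun_apply (rcfc ?g (op_abs T)) x) \<le> 1 / real (Suc n) * norm x"
    by (rule order_trans[OF norm_blinfun mult_right_mono]) simp
  also have "rcfc ?g (op_abs T) = (op_abs T o\<^sub>L approx_proj n) - op_abs T"
    using rcfc_diff[OF positive_op_abs cont continuous_on_id]
      rcfc_mult[OF positive_op_abs continuous_on_id continuous_on_mult_reg_inv]
    by (simp add: rcfc_id[OF positive_op_abs])
  finally show ?thesis
    by (simp add: blinfun.diff_left)
qed

text \<open>The quadratic forms at x increase with n and are bounded, hence converge. The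
  differences of the operators have symbols between 0 and 1, so their squared norms at x are bounded
  by the increments of the forms.\<close>

lemma convergent_approx_proj: "convergent (\<lambda>n. blinfun_apply (approx_proj n) x)"
proof -
  define a where "a n = Re (cinner (blinfun_apply (approx_proj n) x) x)" for n
  have step: "(norm (blinfun_apply (approx_proj n) x - blinfun_apply (approx_proj m) x))\<^sup>2 \<le> a n - a m"
    if "m \<le> n" for m n
  proof -
    let ?g = "\<lambda>x. x * reg_inv n x - x * reg_inv m x"
    have "continuous_on {0..} ?g"
      by (intro continuous_intros continuous_on_reg_inv)
    moreover have "0 \<le> ?g x \<and> ?g x \<le> 1" if "0 \<le> x" for x
      using mult_reg_inv_mono[OF \<open>m \<le> n\<close> that] mult_reg_inv_bounds[OF that, of n]
        mult_reg_inv_bounds[OF that, of m] by linarith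
    ultimately have "(norm (blinfun_apply (rcfc ?g (op_abs T)) x))\<^sup>2
        \<le> Re (cinner (blinfun_apply (rcfc ?g (op_abs T)) x) x)"
      by (rule norm_rcfc_sq_le[OF positive_op_abs])
    then show ?thesis
      by (simp add: a_def blinfun.diff_left cinner_diff_left
          rcfc_diff[OF positive_op_abs continuous_on_mult_reg_inv continuous_on_mult_reg_inv])
  qed
  have "incseq a"
    by (rule incseq_SucI) (metis diff_ge_0_iff_ge le_SucI order_refl order_trans step zero_le_power2)
  moreover have "a n \<le> norm x * norm x" for n
    unfolding a_def
    by (rule order_trans[OF Re_cinner_le mult_right_mono[OF norm_approx_proj_apply]]) simp
  ultimately obtain L where "a \<longlonglongrightarrow> L"
    using incseq_convergent by blast
  then have "Cauchy a"
    by (rule LIMSEQ_imp_Cauchy)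
  have "Cauchy (\<lambda>n. blinfun_apply (approx_proj n) x)"
  proof (rule CauchyI')
    fix e :: real assume "0 < e"
    then obtain N where N: "\<And>m n. N \<le> m \<Longrightarrow> N \<le> n \<Longrightarrow> norm (a m - a n) < e\<^sup>2"
      using CauchyD[OF \<open>Cauchy a\<close>, of "e\<^sup>2"] by auto
    have "dist (blinfun_apply (approx_proj m) x) (blinfun_apply (approx_proj n) x) < e"
      if "N \<le> m" "m < n" for m n
    proof -
      have "(norm (blinfun_apply (approx_proj n) x - blinfun_apply (approx_proj m) x))\<^sup>2 < e\<^sup>2"
        using step[of m n] N[of n m] that by simp
      then show ?thesis
        using \<open>0 < e\<close> by (simp add: dist_norm norm_minus_commute power_less_imp_less_base)
    qed
    then show "\<exists>M. \<forall>m\<ge>M. \<forall>n>m.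
        dist (blinfun_apply (approx_proj m) x) (blinfun_apply (approx_proj n) x) < e"
      by blast
  qed
  then show ?thesis
    by (simp add: Cauchy_convergent_iff)
qed

text \<open>A pointwise limit, because convergence in norm fails when the spectrum of
  \<open>op_abs T\<close> accumulates at 0. The limit projects onto the orthogonal complement of the
  kernel of T.\<close>

definition support :: "'a \<Rightarrow> 'a" where
  "support x = lim (\<lambda>n. blinfun_apply (approx_proj n) x)"

lemma approx_proj_tendsto: "(\<lambda>n. blinfun_apply (approx_proj n) x) \<longlonglongrightarrow> support x"
  unfolding support_def using convergent_approx_proj by (simp add: convergent_LIMSEQ_iff)

lemma op_abs_support: "op_abs T (support x) = op_abs T x"
proof (rule LIMSEQ_unique)
  show "(\<lambda>n. op_abs T (blinfun_apply (approx_proj n) x)) \<longlonglongrightarrow> op_abs T (support x)"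
    by (intro blinfun.tendsto tendsto_const approx_proj_tendsto)
  have "(\<lambda>n. 1 / real (Suc n) * norm x) \<longlonglongrightarrow> 0"
    using tendsto_mult[OF LIMSEQ_Suc[OF lim_1_over_n] tendsto_const[of "norm x"]] by simp
  then have "(\<lambda>n. op_abs T (blinfun_apply (approx_proj n) x) - op_abs T x) \<longlonglongrightarrow> 0"
    by (rule Lim_null_comparison[rotated]) (intro always_eventually allI norm_op_abs_approx_proj)
  then show "(\<lambda>n. op_abs T (blinfun_apply (approx_proj n) x)) \<longlonglongrightarrow> op_abs T x"
    by (simp add: LIM_zero_iff)
qed

lemma diff_support_in_ker: "T (x - support x) = 0"
proof -
  have "norm (T (x - support x)) = norm (op_abs T (x - support x))"
    by (simp only: norm_op_abs_apply)
  then show ?thesis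
    by (simp add: blinfun.diff_right op_abs_support)
qed

text \<open>U carries \<open>approx_proj n\<close> to T composed with \<open>approx_inv n\<close>,
  and it kills \<open>x - support x\<close>, which lies in its kernel. Hence U is determined by T,
  and properties of U can be read off the approximants.\<close>

lemma polar_tendsto:
  fixes U :: "'a \<Rightarrow>\<^sub>L 'a"
  assumes "op_ker U = op_ker T" and "T = U o\<^sub>L op_abs T"
  shows "(\<lambda>n. T (blinfun_apply (approx_inv n) x)) \<longlonglongrightarrow> U x"
proof -
  have "T y = U (op_abs T y)" for y
    using arg_cong[OF assms(2), of "\<lambda>F. blinfun_apply F y"] by simp
  then have "T (blinfun_apply (approx_inv n) x) = U (blinfun_apply (approx_proj n) x)" for n
    by (simp add: approx_proj_eq)
  moreover have "(\<lambda>n. U (blinfun_apply (approx_proj n) x)) \<longlonglongrightarrow> U (support x)"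
    by (intro blinfun.tendsto tendsto_const approx_proj_tendsto)
  moreover have "U (x - support x) = 0"
    using diff_support_in_ker[of x] assms(1) by (auto simp: op_ker_def)
  then have "U (support x) = U x"
    by (simp add: blinfun.diff_right)
  ultimately show ?thesis
    by simp
qed

lemma norm_diff_approx_inv:
  "norm (T (blinfun_apply (approx_inv m) x) - T (blinfun_apply (approx_inv n) x))
    = norm (blinfun_apply (approx_proj m) x - blinfun_apply (approx_proj n) x)"
proof -
  have "norm (T (blinfun_apply (approx_inv m) x - blinfun_apply (approx_inv n) x))
      = norm (op_abs T (blinfun_apply (approx_inv m) x - blinfun_apply (approx_inv n) x))"
    by (simp only: norm_op_abs_apply)
  then show ?thesis
    by (simp add: blinfun.diff_right approx_proj_eq)
qed

text \<open>T and \<open>op_abs T\<close> have equal norms on every vector, so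
  \<open>T (approx_inv n x)\<close> is Cauchy because \<open>approx_proj n x\<close> is, and its
  limit has the norm of \<open>support x\<close>.\<close>

lemma polar_exists:
  "\<exists>U. partial_isometry U \<and> op_ker U = op_ker T \<and> T = U o\<^sub>L op_abs T"
proof -
  define u where "u x = lim (\<lambda>n. T (blinfun_apply (approx_inv n) x))" for x
  have "Cauchy (\<lambda>n. T (blinfun_apply (approx_inv n) x))" for x
    using convergent_Cauchy[OF convergent_approx_proj[of x]]
    unfolding Cauchy_iff norm_diff_approx_inv .
  then have u: "(\<lambda>n. T (blinfun_apply (approx_inv n) x)) \<longlonglongrightarrow> u x" for x
    unfolding u_def by (simp add: Cauchy_convergent_iff convergent_LIMSEQ_iff)
  have inv_bo: "approx_inv n \<in> bounded_ops" for n
    by (rule rcfc_in_bounded_ops[OF positive_op_abs continuous_on_reg_inv])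
  have u_add: "u (x + y) = u x + u y" for x y
    using tendsto_add[OF u[of x] u[of y]] u[of "x + y"] LIMSEQ_unique
    by (simp add: blinfun.add_right)
  have u_scale: "u (c *\<^sub>C x) = c *\<^sub>C u x" for c x
    using bounded_linear.tendsto[OF bounded_linear_scaleC u[of x], of c] u[of "c *\<^sub>C x"]
      LIMSEQ_unique by (simp add: bounded_opsD[OF inv_bo] bounded_opsD[OF T])
  have norm_u: "norm (u x) = norm (support x)" for x
  proof (rule LIMSEQ_unique)
    show "(\<lambda>n. norm (T (blinfun_apply (approx_inv n) x))) \<longlonglongrightarrow> norm (u x)"
      by (intro tendsto_norm u)
    show "(\<lambda>n. norm (T (blinfun_apply (approx_inv n) x))) \<longlonglongrightarrow> norm (support x)"
      using tendsto_norm[OF approx_proj_tendsto[of x]]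
      by (simp add: approx_proj_eq norm_op_abs_apply)
  qed
  have norm_support: "norm (support x) \<le> norm x" for x
    by (rule tendsto_upperbound[OF tendsto_norm[OF approx_proj_tendsto[of x]]])
       (simp_all add: norm_approx_proj_apply)
  have "bounded_linear u"
    by (rule bounded_linear_intro[where K = 1])
       (simp_all add: u_add u_scale scaleR_scaleC norm_u norm_support)
  then have app: "blinfun_apply (Blinfun u) = u"
    by (rule bounded_linear_Blinfun_apply)
  \<comment> \<open>The intertwining lemma with \<open>op_abs T\<close> in all three roles.\<close>
  have inv_commute: "op_abs T (blinfun_apply (approx_inv n) x) = blinfun_apply (approx_inv n) (op_abs T x)" for n x
    by (rule rcfc_intertwine[OF positive_op_abs positive_op_abs
          positive_op_in_bounded_ops[OF positive_op_abs] refl continuous_on_reg_inv, symmetric])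
  have u_abs: "u (op_abs T x) = T x" for x
  proof -
    have "norm (T (blinfun_apply (approx_inv n) (op_abs T x)) - T x) \<le> 1 / real (Suc n) * norm x" for n
    proof -
      have "norm (T (blinfun_apply (approx_inv n) (op_abs T x) - x))
          = norm (op_abs T (blinfun_apply (approx_inv n) (op_abs T x) - x))"
        by (simp only: norm_op_abs_apply)
      then show ?thesis
        using norm_op_abs_approx_proj[of n x]
        by (simp add: blinfun.diff_right approx_proj_eq inv_commute)
    qed
    then have "\<forall>\<^sub>F n in sequentially. norm (T (blinfun_apply (approx_inv n) (op_abs T x)) - T x)
        \<le> 1 / real (Suc n) * norm x"
      by (intro always_eventually allI)
    moreover have "(\<lambda>n. 1 / real (Suc n) * norm x) \<longlonglongrightarrow> 0"
      using tendsto_mult[OF LIMSEQ_Suc[OF lim_1_over_n] tendsto_const[of "norm x"]] by simp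
    ultimately have "(\<lambda>n. T (blinfun_apply (approx_inv n) (op_abs T x)) - T x) \<longlonglongrightarrow> 0"
      by (rule Lim_null_comparison)
    then show ?thesis
      using u LIMSEQ_unique by (metis LIM_zero_iff)
  qed
  have ker_u: "u x = 0 \<longleftrightarrow> T x = 0" for x
  proof
    assume "u x = 0"
    then have "support x = 0"
      using norm_u[of x] by simp
    then show "T x = 0"
      using diff_support_in_ker[of x] by simp
  next
    assume "T x = 0"
    then have "op_abs T x = 0"
      using norm_op_abs_apply[of x] by simp
    then have "op_abs T (blinfun_apply (approx_inv n) x) = 0" for n
      by (simp add: inv_commute)
    then have "approx_proj n x = 0" for n
      by (simp add: approx_proj_eq)
    then have "support x = 0"
      using approx_proj_tendsto[of x] by (simp add: LIMSEQ_const_iff)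
    then show "u x = 0"
      using norm_u[of x] by simp
  qed
  \<comment> \<open>Such an x is orthogonal to \<open>x - support x\<close>, so its squared norm is
    the inner product with \<open>support x\<close>. Cauchy-Schwarz then forces
    \<open>support x\<close> to be at least as long as x.\<close>
  have "norm (u x) = norm x" if "\<forall>y. u y = 0 \<longrightarrow> cinner x y = 0" for x
  proof -
    have "cinner x (x - support x) = 0"
      using that diff_support_in_ker[of x] by (simp add: ker_u)
    then have "norm x * norm x = Re (cinner x (support x))"
      by (simp add: cinner_diff_right cinner_self power2_eq_square flip: of_real_mult)
         (metis Re_complex_of_real)
    also have "\<dots> \<le> norm x * norm (support x)"
      by (rule Re_cinner_le)
    finally have "norm x \<le> norm (support x)"
      by (cases "x = 0") auto
    then show ?thesis
      using norm_support[of x] by (simp add: norm_u)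
  qed
  then have "partial_isometry (Blinfun u)"
    by (simp add: partial_isometry_def bounded_ops_def op_ker_def app u_scale)
  moreover have "op_ker (Blinfun u) = op_ker T"
    by (simp add: op_ker_def app ker_u)
  moreover have "T = Blinfun u o\<^sub>L op_abs T"
    by (rule blinfun_eqI) (simp add: app u_abs)
  ultimately show ?thesis
    by blast
qed

lemma polar_isometry:
  "op_ker (polar_isometry T) = op_ker T" "T = polar_isometry T o\<^sub>L op_abs T"
proof -
  have "\<exists>!U. partial_isometry U \<and> op_ker U = op_ker T \<and> T = U o\<^sub>L op_abs T"
  proof (rule ex_ex1I[OF polar_exists])
    fix U V :: "'a \<Rightarrow>\<^sub>L 'a"
    assume "partial_isometry U \<and> op_ker U = op_ker T \<and> T = U o\<^sub>L op_abs T"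
      and "partial_isometry V \<and> op_ker V = op_ker T \<and> T = V o\<^sub>L op_abs T"
    then show "U = V"
      using polar_tendsto LIMSEQ_unique by (intro blinfun_eqI) blast
  qed
  from theI'[OF this]
  show "op_ker (polar_isometry T) = op_ker T" "T = polar_isometry T o\<^sub>L op_abs T"
    unfolding polar_isometry_def by blast+
qed

lemma norm_polar_isometry_apply: "norm (polar_isometry T x) \<le> norm x"
proof (rule tendsto_upperbound[OF tendsto_norm[OF polar_tendsto[OF polar_isometry]]])
  have "norm (T (blinfun_apply (approx_inv n) x)) \<le> norm x" for n
    using norm_approx_proj_apply[of n x] by (simp add: approx_proj_eq norm_op_abs_apply)
  then show "\<forall>\<^sub>F n in sequentially. norm (T (blinfun_apply (approx_inv n) x)) \<le> norm x"
    by simp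
qed simp

text \<open>On the approximants, \<open>op_abs (adj T)\<close> passes through T and leaves T applied
  to \<open>approx_proj n x\<close>. In the limit this is T at \<open>support x\<close>, which
  agrees with \<open>T x\<close>.\<close>

lemma op_abs_adj_polar: "op_abs (adj T) (polar_isometry T x) = T x"
proof (rule LIMSEQ_unique)
  show "(\<lambda>n. op_abs (adj T) (T (blinfun_apply (approx_inv n) x)))
      \<longlonglongrightarrow> op_abs (adj T) (polar_isometry T x)"
    by (intro blinfun.tendsto tendsto_const polar_tendsto[OF polar_isometry])
  have "(\<lambda>n. T (blinfun_apply (approx_proj n) x)) \<longlonglongrightarrow> T (support x)"
    by (intro blinfun.tendsto tendsto_const approx_proj_tendsto)
  moreover have "T (support x) = T x"
    using diff_support_in_ker[of x] by (simp add: blinfun.diff_right)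
  ultimately show "(\<lambda>n. op_abs (adj T) (T (blinfun_apply (approx_inv n) x))) \<longlonglongrightarrow> T x"
    by (simp add: op_abs_adj_intertwine approx_proj_eq)
qed

end

section \<open>Norm bounds for the mean transform\<close>

text \<open>The Cauchy-Schwarz inequality in the direct sum of two copies of the space, with weights
  l and 1 - l on the summands.\<close>

lemma weighted_Cauchy_Schwarz:
  fixes a b c d :: "'a :: complex_inner" and l :: real
  assumes "0 \<le> l" and "l \<le> 1"
  shows "cmod (of_real l * cinner a b + of_real (1 - l) * cinner c d)
    \<le> sqrt (l * (norm a)\<^sup>2 + (1 - l) * (norm c)\<^sup>2) * sqrt (l * (norm b)\<^sup>2 + (1 - l) * (norm d)\<^sup>2)"
    (is "_ \<le> sqrt ?X * sqrt ?Y")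
proof -
  define m where "m = 1 - l"
  have "0 \<le> m"
    using assms by (simp add: m_def)
  have "cmod (of_real l * cinner a b + of_real m * cinner c d)
      \<le> l * cmod (cinner a b) + m * cmod (cinner c d)"
    using norm_triangle_ineq[of "of_real l * cinner a b" "of_real m * cinner c d"] assms(1) \<open>0 \<le> m\<close>
    by (simp add: norm_mult)
  also have "\<dots> \<le> l * (norm a * norm b) + m * (norm c * norm d)"
    using assms(1) \<open>0 \<le> m\<close> by (intro add_mono mult_left_mono cmod_cinner_le)
  also have "\<dots> \<le> sqrt (?X * ?Y)"
  proof (rule real_le_rsqrt)
    \<comment> \<open>Lagrange's identity exhibits the difference as a weighted square.\<close>
    have "?X * ?Y - (l * (norm a * norm b) + m * (norm c * norm d))\<^sup>2
        = l * m * (norm a * norm d - norm b * norm c)\<^sup>2"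
      unfolding m_def[symmetric] by (simp add: power2_eq_square algebra_simps)
    moreover have "0 \<le> l * m * (norm a * norm d - norm b * norm c)\<^sup>2"
      using assms(1) \<open>0 \<le> m\<close> by simp
    ultimately show "(l * (norm a * norm b) + m * (norm c * norm d))\<^sup>2 \<le> ?X * ?Y"
      by linarith
  qed
  finally show ?thesis
    by (simp add: m_def real_sqrt_mult)
qed

lemma norm_op_pow_apply_le:
  fixes A :: "'a :: chilbert_space \<Rightarrow>\<^sub>L 'a" and \<tau> :: real
  assumes "positive_op A" and "norm A \<le> \<tau>" and "0 \<le> s"
  shows "norm (blinfun_apply (op_pow A s) x) \<le> rpow \<tau> s * norm x"
  using order_trans[OF norm_op_pow_le[OF assms(1,3)] rpow_mono[OF assms(3) norm_ge_zero assms(2)]]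
  by (intro order_trans[OF norm_blinfun mult_right_mono]) simp_all

text \<open>The squared norms are quadratic forms of the doubled powers, so the left side is the
  quadratic form at x of the operator on the right.\<close>

lemma weighted_op_pow_le:
  fixes P Q :: "'a :: chilbert_space \<Rightarrow>\<^sub>L 'a" and l :: real
  assumes P: "positive_op P" and Q: "positive_op Q" and "0 \<le> r" and "0 \<le> s"
  shows "l * (norm (blinfun_apply (op_pow Q r) x))\<^sup>2 + (1 - l) * (norm (blinfun_apply (op_pow P s) x))\<^sup>2
    \<le> norm (l *\<^sub>R op_pow Q (2 * r) + (1 - l) *\<^sub>R op_pow P (2 * s)) * (norm x)\<^sup>2"
proof -
  let ?S = "l *\<^sub>R op_pow Q (2 * r) + (1 - l) *\<^sub>R op_pow P (2 * s)"
  have "l * (norm (blinfun_apply (op_pow Q r) x))\<^sup>2 + (1 - l) * (norm (blinfun_apply (op_pow P s) x))\<^sup>2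
      = Re (cinner (blinfun_apply ?S x) x)"
    by (simp add: norm_op_pow_sq[OF Q] norm_op_pow_sq[OF P] assms blinfun.bilinear_simps
        cinner_add_left cinner_scaleR_left)
  also have "\<dots> \<le> norm ?S * norm x * norm x"
    by (rule order_trans[OF Re_cinner_le mult_right_mono[OF norm_blinfun norm_ge_zero]])
  finally show ?thesis
    by (simp add: power2_eq_square mult.assoc)
qed

context
  fixes P Q :: "'a :: chilbert_space \<Rightarrow>\<^sub>L 'a" and l t \<tau> :: real
  assumes P: "positive_op P" and Q: "positive_op Q"
    and norm_P: "norm P \<le> \<tau>" and norm_Q: "norm Q \<le> \<tau>"
    and l: "0 \<le> l" "l \<le> 1" and t: "0 \<le> t" "t \<le> 1"
begin

text \<open>Because equal powers stand on the u side and the y side, the norm of the weighted sum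
  occurs under both square roots and comes out without a root.\<close>

lemma cinner_mean_le_max:
  "cmod (cinner (l *\<^sub>R Q u + (1 - l) *\<^sub>R P u) y)
    \<le> max (rpow \<tau> t) (rpow \<tau> (1 - t)) * norm (l *\<^sub>R op_pow Q t + (1 - l) *\<^sub>R op_pow P (1 - t))
      * norm u * norm y"
proof -
  let ?K = "max (rpow \<tau> t) (rpow \<tau> (1 - t))" and ?q = "op_pow Q (t / 2)" and ?p = "op_pow P ((1 - t) / 2)"
  let ?N = "norm (l *\<^sub>R op_pow Q t + (1 - l) *\<^sub>R op_pow P (1 - t))"
  let ?a = "blinfun_apply (op_pow Q (1 - t)) (?q u)" and ?c = "blinfun_apply (op_pow P t) (?p u)"
  have "0 \<le> ?K"
    by (simp add: max_def rpow_nonneg)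
  have N: "l * (norm (?q x))\<^sup>2 + (1 - l) * (norm (?p x))\<^sup>2 \<le> ?N * (norm x)\<^sup>2" for x
    using weighted_op_pow_le[OF P Q, of "t / 2" "(1 - t) / 2" l x] t by (simp del: right_diff_distrib_numeral)
  have "cinner (Q u) y = cinner ?a (?q y)"
  proof -
    \<comment> \<open>The exponents \<open>t / 2\<close> and \<open>1 - t / 2\<close> add up to one;
      taking another \<open>t / 2\<close> from the second leaves \<open>1 - t\<close> for the scalar
      estimate. For P the roles of t and 1 - t are exchanged.\<close>
    have "op_pow Q (1 - t / 2) = op_pow Q (1 - t) o\<^sub>L ?q"
      using op_pow_add[OF Q, of "1 - t" "t / 2"] t by (simp add: algebra_simps)
    then show ?thesis
      using cinner_split_op_pow[OF Q, of "t / 2" "1 - t / 2"] t by simp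
  qed
  moreover have "cinner (P u) y = cinner ?c (?p y)"
  proof -
    have "op_pow P ((1 + t) / 2) = op_pow P t o\<^sub>L ?p"
      using op_pow_add[OF P, of t "(1 - t) / 2"] t by (simp add: field_simps)
    then show ?thesis
      using cinner_split_op_pow[OF P, of "(1 - t) / 2" "(1 + t) / 2"] t by (simp add: field_simps)
  qed
  ultimately have "cmod (cinner (l *\<^sub>R Q u + (1 - l) *\<^sub>R P u) y)
      = cmod (of_real l * cinner ?a (?q y) + of_real (1 - l) * cinner ?c (?p y))"
    by (simp add: cinner_add_left cinner_scaleR_left)
  also have "\<dots> \<le> sqrt (l * (norm ?a)\<^sup>2 + (1 - l) * (norm ?c)\<^sup>2)
      * sqrt (l * (norm (?q y))\<^sup>2 + (1 - l) * (norm (?p y))\<^sup>2)"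
    by (rule weighted_Cauchy_Schwarz[OF l])
  also have "\<dots> \<le> sqrt (?K\<^sup>2 * (?N * (norm u)\<^sup>2)) * sqrt (?N * (norm y)\<^sup>2)"
  proof (intro mult_mono real_sqrt_le_mono N)
    have "norm ?a \<le> rpow \<tau> (1 - t) * norm (?q u)"
      using t by (intro norm_op_pow_apply_le[OF Q norm_Q]) simp
    then have "norm ?a \<le> ?K * norm (?q u)"
      by (rule order_trans) (intro mult_right_mono max.cobounded2 norm_ge_zero)
    moreover have "norm ?c \<le> rpow \<tau> t * norm (?p u)"
      using t by (intro norm_op_pow_apply_le[OF P norm_P]) simp
    then have "norm ?c \<le> ?K * norm (?p u)"
      by (rule order_trans) (intro mult_right_mono max.cobounded1 norm_ge_zero)
    ultimately have "l * (norm ?a)\<^sup>2 + (1 - l) * (norm ?c)\<^sup>2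
        \<le> l * (?K * norm (?q u))\<^sup>2 + (1 - l) * (?K * norm (?p u))\<^sup>2"
      using l by (intro add_mono mult_left_mono power_mono) auto
    also have "\<dots> = ?K\<^sup>2 * (l * (norm (?q u))\<^sup>2 + (1 - l) * (norm (?p u))\<^sup>2)"
      by (simp add: power_mult_distrib algebra_simps)
    also have "\<dots> \<le> ?K\<^sup>2 * (?N * (norm u)\<^sup>2)"
      by (intro mult_left_mono N) simp
    finally show "l * (norm ?a)\<^sup>2 + (1 - l) * (norm ?c)\<^sup>2 \<le> ?K\<^sup>2 * (?N * (norm u)\<^sup>2)" .
  qed (use l in simp_all)
  also have "\<dots> = ?K * ?N * norm u * norm y"
    using \<open>0 \<le> ?K\<close> by (simp add: real_sqrt_mult)
  finally show ?thesis .
qed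

text \<open>Here the two sides are treated differently: powers acting on u are estimated by powers
  of \<open>\<tau>\<close>, those acting on y are kept as an operator. The norm of the weighted sum
  thus stays under the root.\<close>

lemma cinner_mean_le_sqrt:
  "cmod (cinner (l *\<^sub>R Q u + (1 - l) *\<^sub>R P u) y)
    \<le> sqrt (norm (l *\<^sub>R op_pow Q (2 * t) + (1 - l) *\<^sub>R op_pow P (2 * (1 - t)))
        * (l * rpow \<tau> (2 * (1 - t)) + (1 - l) * rpow \<tau> (2 * t))) * norm u * norm y"
proof -
  let ?N = "norm (l *\<^sub>R op_pow Q (2 * t) + (1 - l) *\<^sub>R op_pow P (2 * (1 - t)))"
  let ?R = "l * rpow \<tau> (2 * (1 - t)) + (1 - l) * rpow \<tau> (2 * t)"
  let ?a = "op_pow Q (1 - t) u" and ?b = "op_pow Q t y" and ?c = "op_pow P t u"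
    and ?d = "op_pow P (1 - t) y"
  have "rpow \<tau> (2 * s) = (rpow \<tau> s)\<^sup>2" if "0 \<le> s" for s
    using rpow_add[OF that that, of \<tau>] by (simp add: power2_eq_square)
  then have R: "?R = l * (rpow \<tau> (1 - t))\<^sup>2 + (1 - l) * (rpow \<tau> t)\<^sup>2"
    using t by (simp del: right_diff_distrib_numeral)
  have "cmod (cinner (l *\<^sub>R Q u + (1 - l) *\<^sub>R P u) y)
      = cmod (of_real l * cinner ?a ?b + of_real (1 - l) * cinner ?c ?d)"
    using cinner_split_op_pow[OF Q, of t "1 - t"] cinner_split_op_pow[OF P, of "1 - t" t] t
    by (simp add: cinner_add_left cinner_scaleR_left)
  also have "\<dots> \<le> sqrt (l * (norm ?a)\<^sup>2 + (1 - l) * (norm ?c)\<^sup>2)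
      * sqrt (l * (norm ?b)\<^sup>2 + (1 - l) * (norm ?d)\<^sup>2)"
    by (rule weighted_Cauchy_Schwarz[OF l])
  also have "\<dots> \<le> sqrt (?R * (norm u)\<^sup>2) * sqrt (?N * (norm y)\<^sup>2)"
  proof (intro mult_mono real_sqrt_le_mono)
    have "l * (norm ?a)\<^sup>2 + (1 - l) * (norm ?c)\<^sup>2
        \<le> l * (rpow \<tau> (1 - t) * norm u)\<^sup>2 + (1 - l) * (rpow \<tau> t * norm u)\<^sup>2"
      using l t norm_op_pow_apply_le[OF Q norm_Q] norm_op_pow_apply_le[OF P norm_P]
      by (intro add_mono mult_left_mono power_mono) auto
    also have "\<dots> = ?R * (norm u)\<^sup>2"
      unfolding R by (simp add: power_mult_distrib algebra_simps)
    finally show "l * (norm ?a)\<^sup>2 + (1 - l) * (norm ?c)\<^sup>2 \<le> ?R * (norm u)\<^sup>2" .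
    show "l * (norm ?b)\<^sup>2 + (1 - l) * (norm ?d)\<^sup>2 \<le> ?N * (norm y)\<^sup>2"
      using t by (intro weighted_op_pow_le P Q) auto
  qed (use l rpow_nonneg in auto)
  also have "\<dots> = sqrt (?N * ?R) * norm u * norm y"
    by (simp add: real_sqrt_mult)
  finally show ?thesis .
qed

end

lemma mean_transform_apply:
  assumes "T \<in> bounded_ops"
  shows "blinfun_apply (mean_transform l T) x
    = l *\<^sub>R blinfun_apply (op_abs (adj T)) (blinfun_apply (polar_isometry T) x)
      + (1 - l) *\<^sub>R blinfun_apply (op_abs T) (blinfun_apply (polar_isometry T) x)"
  by (simp add: mean_transform_def duggal_def blinfun.bilinear_simps op_abs_adj_polar[OF assms])

theorem theorem16:
  fixes T :: "'a :: chilbert_space \<Rightarrow>\<^sub>L 'a" and l t :: real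
  assumes "T \<in> bounded_ops" and "l \<in> {0..1}" and "t \<in> {0..1}"
  shows "norm (mean_transform l T)
           \<le> max (rpow (norm T) t) (rpow (norm T) (1 - t)) *
             norm (l *\<^sub>R op_pow (op_abs (adj T)) t + (1 - l) *\<^sub>R op_pow (op_abs T) (1 - t))
       \<and> norm (mean_transform l T)
           \<le> sqrt (norm (l *\<^sub>R op_pow (op_abs (adj T)) (2 * t)
                         + (1 - l) *\<^sub>R op_pow (op_abs T) (2 * (1 - t))) *
                   (l * rpow (norm T) (2 * (1 - t)) + (1 - l) * rpow (norm T) (2 * t)))"
proof -
  note T = assms(1)
  note T' = adj_in_bounded_ops[OF T]
  have l: "0 \<le> l" "l \<le> 1" and t: "0 \<le> t" "t \<le> 1"
    using assms by auto
  have norm_T': "norm (op_abs (adj T)) \<le> norm T"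
    using norm_op_abs_le[OF T'] norm_adj_le[OF T] by linarith
  note bounds = positive_op_abs[OF T] positive_op_abs[OF T'] norm_op_abs_le[OF T] norm_T' l t
  \<comment> \<open>The form is bounded for arbitrary u and then evaluated at u = U x, where the
    contraction property replaces the norm of U x by that of x.\<close>
  have reduce: "norm (mean_transform l T) \<le> K"
    if K: "0 \<le> K" and bound: "\<And>u y. cmod (cinner (l *\<^sub>R op_abs (adj T) u + (1 - l) *\<^sub>R op_abs T u) y)
      \<le> K * norm u * norm y" for K
  proof (rule norm_blinfun_bound[OF K])
    fix x
    have "norm (mean_transform l T x) \<le> K * norm (polar_isometry T x)"
      unfolding mean_transform_apply[OF T] by (rule norm_le_via_cinner) (use K bound in simp_all)
    also have "\<dots> \<le> K * norm x"
      using K by (intro mult_left_mono norm_polar_isometry_apply[OF T])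
    finally show "norm (mean_transform l T x) \<le> K * norm x" .
  qed
  show ?thesis
    using l by (intro conjI reduce cinner_mean_le_max[OF bounds] cinner_mean_le_sqrt[OF bounds])
      (auto simp: max_def rpow_nonneg)
qed

end
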